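(* Let $Q$ be a smooth $n$-dimensional manifold with a Riemannian metric $\mathcal{G}$, and let $\mathcal{D}\subseteq TQ$ be a regular (i.e. smooth, constant-rank), non-integrable distribution on $Q$, with inclusion map $i_{\mathcal{D}}:\mathcal{D}\hookrightarrow TQ$. Let $\mathcal{P}:TQ\to\mathcal{D}$ be the fibrewise $\mathcal{G}$-orthogonal projection associated with the decomposition $TQ=\mathcal{D}\oplus\mathcal{D}^{\perp}$. Let $R_d:U\subseteq TTQ\to TQ\times TQ$ be a discretization map on the manifold $TQ$, where $U$ is an open neighborhood of the zero section of $TTQ\to TQ$. Define $$R_{\mathcal{D},d}:=(\mathcal{P}\times\mathcal{P})\circ R_d\circ Ti_{\mathcal{D}}:\ (Ti_{\mathcal{D}})^{-1}(U)\subseteq T\mathcal{D}\longrightarrow \mathcal{D}\times\mathcal{D},$$ where $Ti_{\mathcal{D}}:T\mathcal{D}\to TTQ$ is the tangent map of $i_{\mathcal{D}}$. Then $R_{\mathcal{D},d}$ is a discretization map on the manifold $\mathcal{D}$.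
   Context: Definition (discretization map). Let $M$ be a smooth manifold and let $U\subseteq TM$ be an open neighborhood of the zero section of $TM$. For $x\in M$ let $0_x$ denote the zero vector of $T_xM$. A smooth map $R_d:U\to M\times M$, written $R_d(x,v)=(R^1(x,v),R^2(x,v))$ for $v\in T_xM$, is a discretization map on $M$ if, for every $x\in M$: 1. $R_d(x,0)=(x,x)$; 2. writing $R^a_x$ for the restriction of $R^a$ to $U\cap T_xM$ ($a=1,2$), the linear map $T_{0_x}R^2_x-T_{0_x}R^1_x: T_{0_x}T_xM\simeq T_xM\to T_xM$ is the identity map of $T_xM$. (Here $T_{0_x}T_xM$ is canonically identified with $T_xM$, and by condition 1 both tangent maps $T_{0_x}R^a_x$ take values in $T_xM$.) In the claim this definition is used with $M=TQ$ (for $R_d$) and with $M=\mathcal{D}$ (for $R_{\mathcal{D},d}$), where $\mathcal{D}$ is regarded as a smooth manifold, namely the total space of a vector subbundle of $TQ$. $\mathcal{D}^{\perp}$ denotes the $\mathcal{G}$-orthogonal complement of $\mathcal{D}$ in $TQ$. Non-integrable means that the sections of $\mathcal{D}$ are not closed under the Lie bracket of vector fields. *)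

theory Defs
  imports "HOL-Analysis.Analysis"
begin

section \<open>Smooth maps between Euclidean spaces\<close>

text \<open>The set \<open>S\<close> is meant to be open. Continuity of all directional derivatives, together with
  differentiability, is continuity of the derivative because the domain is finite-dimensional.\<close>

fun Ck_on :: "nat \<Rightarrow> 'e::euclidean_space set \<Rightarrow> ('e \<Rightarrow> 'f::euclidean_space) \<Rightarrow> bool" where
  "Ck_on 0 S f \<longleftrightarrow> continuous_on S f"
| "Ck_on (Suc k) S f \<longleftrightarrow>
     (\<forall>x\<in>S. f differentiable (at x)) \<and>
     (\<forall>v. Ck_on k S (\<lambda>x. frechet_derivative f (at x) v))"

definition smooth_on :: "'e::euclidean_space set \<Rightarrow> ('e \<Rightarrow> 'f::euclidean_space) \<Rightarrow> bool" where
  "smooth_on S f \<longleftrightarrow> (\<forall>k. Ck_on k S f)"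

section \<open>Smooth manifolds\<close>

text \<open>A chart is a domain together with a map that is relevant only on this domain. A manifold is
  given by an atlas (not necessarily maximal): the underlying set is the union of the chart domains,
  and its topology is the one that makes all charts homeomorphisms onto open sets.
  The dimension is that of the model space \<open>'e\<close>.\<close>

type_synonym ('a, 'e) chart = "'a set \<times> ('a \<Rightarrow> 'e)"

definition points :: "('a, 'e) chart set \<Rightarrow> 'a set" where
  "points A = \<Union> (fst ` A)"

definition atlas_topology :: "('a, 'e::euclidean_space) chart set \<Rightarrow> 'a topology" where
  "atlas_topology A =
     topology (\<lambda>W. W \<subseteq> points A \<and> (\<forall>(U, \<phi>)\<in>A. open (\<phi> ` (W \<inter> U))))"

definition chart_inv :: "('a, 'e) chart \<Rightarrow> 'e \<Rightarrow> 'a" where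
  "chart_inv c = inv_into (fst c) (snd c)"

definition local_rep :: "('a, 'e) chart \<Rightarrow> ('b, 'f) chart \<Rightarrow> ('a \<Rightarrow> 'b) \<Rightarrow> 'e \<Rightarrow> 'f" where
  "local_rep c d f = snd d \<circ> f \<circ> chart_inv c"

definition smooth_manifold :: "('a, 'e::euclidean_space) chart set \<Rightarrow> bool" where
  "smooth_manifold A \<longleftrightarrow>
     (\<forall>(U, \<phi>)\<in>A. inj_on \<phi> U \<and> open (\<phi> ` U)) \<and>
     (\<forall>(U, \<phi>)\<in>A. \<forall>(V, \<psi>)\<in>A.
        open (\<phi> ` (U \<inter> V)) \<and> smooth_on (\<phi> ` (U \<inter> V)) (local_rep (U, \<phi>) (V, \<psi>) id)) \<and>
     Hausdorff_space (atlas_topology A) \<and> second_countable (atlas_topology A)"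

definition smooth_map ::
  "('a, 'e::euclidean_space) chart set \<Rightarrow> ('b, 'f::euclidean_space) chart set
     \<Rightarrow> 'a set \<Rightarrow> ('a \<Rightarrow> 'b) \<Rightarrow> bool" where
  "smooth_map A B W f \<longleftrightarrow>
     openin (atlas_topology A) W \<and> f ` W \<subseteq> points B \<and>
     (\<forall>(U, \<phi>)\<in>A. \<forall>(V, \<psi>)\<in>B.
        open (\<phi> ` (U \<inter> W \<inter> f -` V)) \<and>
        smooth_on (\<phi> ` (U \<inter> W \<inter> f -` V)) (local_rep (U, \<phi>) (V, \<psi>) f))"

definition euclidean_atlas :: "('e, 'e) chart set" where
  "euclidean_atlas = {(UNIV, id)}"

definition prod_atlas ::
  "('a, 'e) chart set \<Rightarrow> ('b, 'f) chart set \<Rightarrow> ('a \<times> 'b, 'e \<times> 'f) chart set" where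
  "prod_atlas A B = {(U \<times> V, map_prod \<phi> \<psi>) |U \<phi> V \<psi>. (U, \<phi>) \<in> A \<and> (V, \<psi>) \<in> B}"

section \<open>Tangent bundle and tangent maps\<close>

text \<open>A chart at \<open>p\<close> is chosen once and for all for every point \<open>p\<close>. A tangent vector at \<open>p\<close>, that is
  a compatible family of coordinate vectors, one for each chart around \<open>p\<close>, is represented by its
  coordinate vector in the chosen chart. So each tangent space is the vector space \<open>'e\<close>, the
  tangent bundle is \<open>points A \<times> UNIV\<close>, and the coordinates \<open>to_coords A c p v\<close> of \<open>(p, v)\<close> in any
  other chart \<open>c\<close> around \<open>p\<close> are obtained by the derivative of the change of charts.\<close>

definition chart_at :: "('a, 'e) chart set \<Rightarrow> 'a \<Rightarrow> ('a, 'e) chart" where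
  "chart_at A p = (SOME c. c \<in> A \<and> p \<in> fst c)"

definition to_coords ::
  "('a, 'e::euclidean_space) chart set \<Rightarrow> ('a, 'e) chart \<Rightarrow> 'a \<Rightarrow> 'e \<Rightarrow> 'e" where
  "to_coords A c p =
     frechet_derivative (local_rep (chart_at A p) c id) (at (snd (chart_at A p) p))"

definition from_coords ::
  "('a, 'e::euclidean_space) chart set \<Rightarrow> ('a, 'e) chart \<Rightarrow> 'a \<Rightarrow> 'e \<Rightarrow> 'e" where
  "from_coords A c p =
     frechet_derivative (local_rep c (chart_at A p) id) (at (snd c p))"

definition tangent_atlas ::
  "('a, 'e::euclidean_space) chart set \<Rightarrow> ('a \<times> 'e, 'e \<times> 'e) chart set" where
  "tangent_atlas A =
     {(U \<times> UNIV, \<lambda>(p, v). (\<phi> p, to_coords A (U, \<phi>) p v)) |U \<phi>. (U, \<phi>) \<in> A}"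

definition tangent_map_at ::
  "('a, 'e::euclidean_space) chart set \<Rightarrow> ('b, 'f::euclidean_space) chart set
     \<Rightarrow> ('a \<Rightarrow> 'b) \<Rightarrow> 'a \<Rightarrow> 'e \<Rightarrow> 'f" where
  "tangent_map_at A B f p =
     frechet_derivative (local_rep (chart_at A p) (chart_at B (f p)) f)
       (at (snd (chart_at A p) p))"

definition tangent_map ::
  "('a, 'e::euclidean_space) chart set \<Rightarrow> ('b, 'f::euclidean_space) chart set
     \<Rightarrow> ('a \<Rightarrow> 'b) \<Rightarrow> 'a \<times> 'e \<Rightarrow> 'b \<times> 'f" where
  "tangent_map A B f = (\<lambda>(p, v). (f p, tangent_map_at A B f p v))"

section \<open>Discretization maps\<close>

text \<open>The fibre \<open>T\<^sub>xM\<close> is the vector space \<open>'e\<close>; using \<open>euclidean_atlas\<close> for it is the canonical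
  identification of the tangent space of \<open>T\<^sub>xM\<close> at \<open>0\<^sub>x\<close> with \<open>T\<^sub>xM\<close> itself.\<close>

definition discretization_map ::
  "('a, 'e::euclidean_space) chart set \<Rightarrow> ('a \<times> 'e) set \<Rightarrow> ('a \<times> 'e \<Rightarrow> 'a \<times> 'a) \<Rightarrow> bool" where
  "discretization_map A U R \<longleftrightarrow>
     smooth_manifold A \<and>
     openin (atlas_topology (tangent_atlas A)) U \<and>
     (\<forall>x\<in>points A. (x, 0) \<in> U) \<and>
     smooth_map (tangent_atlas A) (prod_atlas A A) U R \<and>
     (\<forall>x\<in>points A.
        R (x, 0) = (x, x) \<and>
        (\<forall>v. tangent_map_at euclidean_atlas A (\<lambda>u. snd (R (x, u))) 0 v
             - tangent_map_at euclidean_atlas A (\<lambda>u. fst (R (x, u))) 0 v = v))"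

section \<open>Vector fields, Riemannian metrics and distributions\<close>

definition smooth_vector_field ::
  "('a, 'e::euclidean_space) chart set \<Rightarrow> 'a set \<Rightarrow> ('a \<Rightarrow> 'e) \<Rightarrow> bool" where
  "smooth_vector_field A W X \<longleftrightarrow> smooth_map A (tangent_atlas A) W (\<lambda>p. (p, X p))"

definition local_field ::
  "('a, 'e::euclidean_space) chart set \<Rightarrow> ('a, 'e) chart \<Rightarrow> ('a \<Rightarrow> 'e) \<Rightarrow> 'e \<Rightarrow> 'e" where
  "local_field A c X x = to_coords A c (chart_inv c x) (X (chart_inv c x))"

definition lie_bracket ::
  "('a, 'e::euclidean_space) chart set \<Rightarrow> ('a \<Rightarrow> 'e) \<Rightarrow> ('a \<Rightarrow> 'e) \<Rightarrow> 'a \<Rightarrow> 'e" where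
  "lie_bracket A X Y p =
     (let c = chart_at A p; x = snd c p; X' = local_field A c X; Y' = local_field A c Y in
        frechet_derivative Y' (at x) (X' x) - frechet_derivative X' (at x) (Y' x))"

definition riemannian_metric ::
  "('a, 'e::euclidean_space) chart set \<Rightarrow> ('a \<Rightarrow> 'e \<Rightarrow> 'e \<Rightarrow> real) \<Rightarrow> bool" where
  "riemannian_metric A G \<longleftrightarrow>
     (\<forall>p\<in>points A. bilinear (G p) \<and> (\<forall>v w. G p v w = G p w v) \<and> (\<forall>v. v \<noteq> 0 \<longrightarrow> 0 < G p v v)) \<and>
     (\<forall>(U, \<phi>)\<in>A. \<forall>a b. smooth_on (\<phi> ` U)
        (\<lambda>x. let p = chart_inv (U, \<phi>) x in
           G p (from_coords A (U, \<phi>) p a) (from_coords A (U, \<phi>) p b)))"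

definition fibre :: "('a \<times> 'e) set \<Rightarrow> 'a \<Rightarrow> 'e set" where
  "fibre D p = {v. (p, v) \<in> D}"

definition regular_distribution ::
  "('a, 'e::euclidean_space) chart set \<Rightarrow> nat \<Rightarrow> ('a \<times> 'e) set \<Rightarrow> bool" where
  "regular_distribution A k D \<longleftrightarrow>
     D \<subseteq> points (tangent_atlas A) \<and>
     (\<forall>p\<in>points A. subspace (fibre D p) \<and> dim (fibre D p) = k) \<and>
     (\<forall>p\<in>points A. \<exists>W X. openin (atlas_topology A) W \<and> p \<in> W \<and>
        (\<forall>i<k. smooth_vector_field A W (X i)) \<and>
        (\<forall>q\<in>W. span ((\<lambda>i. X i q) ` {..<k}) = fibre D q))"

definition distribution_section ::
  "('a, 'e::euclidean_space) chart set \<Rightarrow> ('a \<times> 'e) set \<Rightarrow> ('a \<Rightarrow> 'e) \<Rightarrow> bool" where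
  "distribution_section A D X \<longleftrightarrow>
     smooth_vector_field A (points A) X \<and> (\<forall>p\<in>points A. X p \<in> fibre D p)"

definition non_integrable ::
  "('a, 'e::euclidean_space) chart set \<Rightarrow> ('a \<times> 'e) set \<Rightarrow> bool" where
  "non_integrable A D \<longleftrightarrow>
     \<not> (\<forall>X Y. distribution_section A D X \<and> distribution_section A D Y
            \<longrightarrow> distribution_section A D (lie_bracket A X Y))"

text \<open>The total space of a distribution as a manifold. A local frame over \<open>W\<close> is given by its
  trivialization \<open>F p :: 'f \<Rightarrow> 'e\<close>, a linear isomorphism onto the fibre over \<open>p\<close> depending smoothly
  on \<open>p\<close>; the charts are \<open>(p, F p c) \<mapsto> (\<phi> p, c)\<close>. The dimension of \<open>'f\<close> has to be the rank.\<close>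

definition local_trivialization ::
  "('a, 'e::euclidean_space) chart set \<Rightarrow> ('a \<times> 'e) set \<Rightarrow> 'a set
     \<Rightarrow> ('a \<Rightarrow> 'f::euclidean_space \<Rightarrow> 'e) \<Rightarrow> bool" where
  "local_trivialization A D W F \<longleftrightarrow>
     openin (atlas_topology A) W \<and>
     (\<forall>c. smooth_vector_field A W (\<lambda>p. F p c)) \<and>
     (\<forall>p\<in>W. linear (F p) \<and> inj (F p) \<and> range (F p) = fibre D p)"

definition distribution_atlas ::
  "('a, 'e::euclidean_space) chart set \<Rightarrow> ('a \<times> 'e) set
     \<Rightarrow> ('a \<times> 'e, 'e \<times> 'f::euclidean_space) chart set" where
  "distribution_atlas A D =
     {({w \<in> D. fst w \<in> U \<inter> W}, \<lambda>(p, v). (\<phi> p, inv (F p) v)) |U \<phi> W F.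
        (U, \<phi>) \<in> A \<and> local_trivialization A D W F}"

definition orthogonal_complement ::
  "('a \<Rightarrow> 'e \<Rightarrow> 'e \<Rightarrow> real) \<Rightarrow> ('a \<times> 'e) set \<Rightarrow> ('a \<times> 'e) set" where
  "orthogonal_complement G D = {(p, v). \<forall>u\<in>fibre D p. G p v u = 0}"

definition orthogonal_projection ::
  "('a \<Rightarrow> 'e::euclidean_space \<Rightarrow> 'e \<Rightarrow> real) \<Rightarrow> ('a \<times> 'e) set \<Rightarrow> 'a \<times> 'e \<Rightarrow> 'a \<times> 'e" where
  "orthogonal_projection G D = (\<lambda>(p, v).
     (p, THE w. w \<in> fibre D p \<and> v - w \<in> fibre (orthogonal_complement G D) p))"

end

theory Submission
  imports Defs
begin

text \<open>Write \<open>i\<close> for the inclusion of \<open>\<D>\<close> into \<open>TQ\<close>. In the coordinates given by a local frame of \<open>\<D>\<close>, the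
  orthogonal projection \<open>\<P>\<close> is the solution of a linear system with the Gram matrix of the frame, so
  \<open>\<P>\<close> is smooth; as \<open>\<P> \<circ> i = id\<close>, the charts of \<open>\<D>\<close> are smoothly compatible and its topology is the
  subspace topology. Hence the projected map is smooth on an open set. Its restriction to \<open>T\<^sub>x\<D>\<close>
  is \<open>R\<^sub>d\<close> restricted to \<open>T\<^sub>xTQ\<close>, preceded by the linear map \<open>T\<^sub>xi\<close> and followed by \<open>\<P> \<times> \<P>\<close>, so by
  the chain rule the difference of its two derivatives at \<open>0\<^sub>x\<close> is
  \<open>T\<^sub>x\<P> \<circ> id \<circ> T\<^sub>xi = T\<^sub>x(\<P> \<circ> i) = id\<close>.\<close>

section \<open>Calculus of smooth maps\<close>

text \<open>Two features of the encoding shape the argument. A tangent vector is stored in the chart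
  chosen at its base point, and this choice varies arbitrarily from point to point; computations
  therefore go through derivatives of local representations in arbitrary charts, where the choices
  cancel. Moreover, metric, frames and derivatives are known to be smooth only on fixed vectors, so
  a map that is linear in a moving argument is expanded in a basis. The Gram system serves twice: a
  vector of the distribution is its own projection, so \<open>smooth_on_frame_coords\<close> yields
  both the transition maps of the distribution and the smoothness of the projection. The derivative
  of the projection can be pulled out of the difference because both components of the
  discretization map take the value \<open>x\<close> at \<open>(x, 0)\<close>: both are followed by
  the same linear map. Hausdorffness and second countability are inherited from \<open>TQ\<close>,
  where they are part of the assumed discretization map.\<close>

lemma has_derivative_cong_open:
  assumes "open S" "x \<in> S" "\<And>y. y \<in> S \<Longrightarrow> f y = g y"
  shows "(f has_derivative D) (at x) \<longleftrightarrow> (g has_derivative D) (at x)"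
  using has_derivative_transform_within_open[of f D x UNIV S g]
    has_derivative_transform_within_open[of g D x UNIV S f] assms by auto

lemma frechet_derivative_cong_open:
  assumes "open S" "x \<in> S" "\<And>y. y \<in> S \<Longrightarrow> f y = g y"
  shows "frechet_derivative f (at x) = frechet_derivative g (at x)"
  unfolding frechet_derivative_def using has_derivative_cong_open[OF assms] by simp

lemma differentiable_cong_open:
  assumes "open S" "x \<in> S" "\<And>y. y \<in> S \<Longrightarrow> f y = g y"
  shows "f differentiable (at x) \<longleftrightarrow> g differentiable (at x)"
  unfolding differentiable_def using has_derivative_cong_open[OF assms] by simp

text \<open>Openness of \<open>S\<close> lets agreement on \<open>S\<close> pass to the Frechet
  derivatives at its points, hence to all orders.\<close>

lemma Ck_on_cong:
  assumes "open S" "\<And>x. x \<in> S \<Longrightarrow> f x = g x"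
  shows "Ck_on k S f \<longleftrightarrow> Ck_on k S g"
  using assms(2)
proof (induction k arbitrary: f g)
  case 0
  then show ?case using continuous_on_cong[of S S f g] by simp
next
  case (Suc k)
  have "Ck_on k S (\<lambda>x. frechet_derivative f (at x) v) \<longleftrightarrow> Ck_on k S (\<lambda>x. frechet_derivative g (at x) v)" for v
  proof (rule Suc.IH)
    show "frechet_derivative f (at x) v = frechet_derivative g (at x) v" if "x \<in> S" for x
      using frechet_derivative_cong_open[OF assms(1) that, of f g] Suc.prems by simp
  qed
  moreover have "(\<forall>x\<in>S. f differentiable (at x)) \<longleftrightarrow> (\<forall>x\<in>S. g differentiable (at x))"
    using differentiable_cong_open[OF assms(1), of _ f g] Suc.prems by blast
  ultimately show ?case unfolding Ck_on.simps by blast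
qed

lemma Ck_on_subset: "Ck_on k S f \<Longrightarrow> T \<subseteq> S \<Longrightarrow> Ck_on k T f"
proof (induction k arbitrary: f)
  case (Suc k)
  then show ?case unfolding Ck_on.simps by blast
qed (simp add: continuous_on_subset)

text \<open>Derivatives in \<open>Ck_on\<close> are taken \<open>at x\<close>, not within
  \<open>S\<close>. So only order zero needs an argument, and there continuity on an open set around
  \<open>x\<close> gives continuity at \<open>x\<close>.\<close>

lemma Ck_on_local:
  assumes "\<And>x. x \<in> S \<Longrightarrow> \<exists>T. open T \<and> x \<in> T \<and> Ck_on k T f"
  shows "Ck_on k S f"
  using assms
proof (induction k arbitrary: f)
  case 0
  have "continuous (at x within S) f" if "x \<in> S" for x
    using 0[OF that] by (auto simp: continuous_on_eq_continuous_at intro: continuous_at_imp_continuous_at_within)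
  then show ?case by (simp add: continuous_on_eq_continuous_within)
next
  case (Suc k)
  have "Ck_on k S (\<lambda>x. frechet_derivative f (at x) v)" for v
    by (rule Suc.IH) (use Suc.prems in fastforce)
  moreover have "\<forall>x\<in>S. f differentiable (at x)"
    using Suc.prems by fastforce
  ultimately show ?case by simp
qed

lemma Ck_on_SucD: "Ck_on (Suc k) S f \<Longrightarrow> Ck_on k S f"
proof (induction k arbitrary: f)
  case 0
  then show ?case
    by (auto intro!: continuous_at_imp_continuous_on differentiable_imp_continuous_within)
next
  case (Suc k)
  from Suc.prems have "\<forall>x\<in>S. f differentiable (at x)"
    and D: "\<And>v. Ck_on (Suc k) S (\<lambda>x. frechet_derivative f (at x) v)"
    unfolding Ck_on.simps(2)[of "Suc k"] by blast+
  then show ?case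
    by (simp add: Suc.IH[OF D])
qed

lemma Ck_on_has_derivative:
  "Ck_on (Suc k) S f \<Longrightarrow> x \<in> S \<Longrightarrow> (f has_derivative frechet_derivative f (at x)) (at x)"
  using frechet_derivative_works by auto

lemma Ck_on_frechet_derivative: "Ck_on (Suc k) S f \<Longrightarrow> Ck_on k S (\<lambda>x. frechet_derivative f (at x) v)"
  unfolding Ck_on.simps by blast

text \<open>By uniqueness of the derivative an explicit formula may replace
  \<open>frechet_derivative\<close>; the inductions below differentiate once and treat that formula
  by their hypothesis.\<close>

lemma Ck_on_SucI:
  assumes "open S" "\<And>x. x \<in> S \<Longrightarrow> (f has_derivative f' x) (at x)" "\<And>v. Ck_on k S (\<lambda>x. f' x v)"
  shows "Ck_on (Suc k) S f"
proof -
  have "frechet_derivative f (at x) = f' x" if "x \<in> S" for x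
    using frechet_derivative_at[OF assms(2)[OF that]] by simp
  then have "Ck_on k S (\<lambda>x. frechet_derivative f (at x) v)" for v
    using Ck_on_cong[OF assms(1), of "\<lambda>x. frechet_derivative f (at x) v" "\<lambda>x. f' x v" k] assms(3)[of v] by metis
  then show ?thesis
    unfolding Ck_on.simps using differentiableI[OF assms(2)] by blast
qed

section \<open>Closure properties of the classes C^k\<close>

lemma Ck_on_const: "Ck_on k S (\<lambda>x. c)"
proof (induction k arbitrary: c)
  case (Suc k)
  have "frechet_derivative (\<lambda>x. c) (at x) = (\<lambda>v. 0)" for x :: 'a
    using frechet_derivative_at[OF has_derivative_const] by metis
  then show ?case using Suc by simp
qed simp

lemma Ck_on_linear:
  assumes "linear f" shows "Ck_on k S f"
proof (cases k)
  case 0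
  then show ?thesis using linear_continuous_on[of f S] assms by (simp add: linear_conv_bounded_linear)
next
  case (Suc j)
  have "(f has_derivative f) (at x)" for x
    using assms by (simp add: linear_imp_has_derivative)
  then have "f differentiable (at x)" "frechet_derivative f (at x) = f" for x
    using frechet_derivative_at[of f f x] by (auto simp: differentiable_def)
  then show ?thesis using Suc by (simp add: Ck_on_const)
qed

lemma Ck_on_add:
  assumes "open S" "Ck_on k S f" "Ck_on k S g"
  shows "Ck_on k S (\<lambda>x. f x + g x)"
  using assms(2,3)
proof (induction k arbitrary: f g)
  case 0
  then show ?case by (auto intro: continuous_intros)
next
  case (Suc k)
  show ?case
  proof (rule Ck_on_SucI[OF assms(1)])
    show "((\<lambda>x. f x + g x) has_derivative
       (\<lambda>v. frechet_derivative f (at x) v + frechet_derivative g (at x) v)) (at x)" if "x \<in> S" for x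
      by (intro has_derivative_add Ck_on_has_derivative[OF Suc.prems(1) that]
          Ck_on_has_derivative[OF Suc.prems(2) that])
  qed (intro Suc.IH Ck_on_frechet_derivative Suc.prems)
qed

lemma Ck_on_sum:
  assumes "open S" "\<And>i. i \<in> I \<Longrightarrow> Ck_on k S (f i)"
  shows "Ck_on k S (\<lambda>x. \<Sum>i\<in>I. f i x)"
  using assms(2)
proof (induction I rule: infinite_finite_induct)
  case (insert i I)
  have "Ck_on k S (\<lambda>x. f i x + (\<Sum>i\<in>I. f i x))"
    by (intro Ck_on_add[OF assms(1)] insert) simp_all
  then show ?case using insert(1,2) by simp
qed (simp_all add: Ck_on_const)

text \<open>The Leibniz formula is again a sum of values of \<open>h\<close> at less regular pairs,
  so the induction lets both arguments vary.\<close>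

lemma Ck_on_bilinear:
  assumes "bounded_bilinear h" "open S" "Ck_on k S f" "Ck_on k S g"
  shows "Ck_on k S (\<lambda>x. h (f x) (g x))"
  using assms(3,4)
proof (induction k arbitrary: f g)
  case 0
  then show ?case by (simp add: bounded_bilinear.continuous_on[OF assms(1)])
next
  case (Suc k)
  show ?case
  proof (rule Ck_on_SucI[OF assms(2)])
    show "((\<lambda>x. h (f x) (g x)) has_derivative
       (\<lambda>v. h (f x) (frechet_derivative g (at x) v) + h (frechet_derivative f (at x) v) (g x))) (at x)"
      if "x \<in> S" for x
      by (intro bounded_bilinear.FDERIV[OF assms(1)] Ck_on_has_derivative[OF Suc.prems(1) that]
          Ck_on_has_derivative[OF Suc.prems(2) that])
    show "Ck_on k S (\<lambda>x. h (f x) (frechet_derivative g (at x) v) + h (frechet_derivative f (at x) v) (g x))" for v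
      by (intro Ck_on_add[OF assms(2)] Suc.IH Ck_on_frechet_derivative Suc.prems Ck_on_SucD[OF Suc.prems(1)]
          Ck_on_SucD[OF Suc.prems(2)])
  qed
qed

text \<open>Proved ahead of the general chain rule, which uses it for the coordinate
  functionals.\<close>

lemma Ck_on_linear_compose:
  assumes "linear L" "open S" "Ck_on k S f"
  shows "Ck_on k S (\<lambda>x. L (f x))"
  using assms(3)
proof (induction k arbitrary: f)
  case 0
  have "continuous_on (f ` S) L"
    using assms(1) by (simp add: linear_conv_bounded_linear linear_continuous_on)
  then show ?case using 0 continuous_on_compose2[of "f ` S" L S f] by simp
next
  case (Suc k)
  show ?case
  proof (rule Ck_on_SucI[OF assms(2)])
    show "((\<lambda>x. L (f x)) has_derivative (\<lambda>v. L (frechet_derivative f (at x) v))) (at x)" if "x \<in> S" for x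
      using assms(1) by (intro bounded_linear.has_derivative[of L] Ck_on_has_derivative[OF Suc.prems that])
        (simp add: linear_conv_bounded_linear)
  qed (intro Suc.IH Ck_on_frechet_derivative Suc.prems)
qed

text \<open>The derivative of \<open>g\<close> at \<open>f x\<close> is applied to a vector that
  moves with \<open>x\<close>. Expanding this vector in the basis leaves scalar multiples of
  derivatives of \<open>g\<close> in fixed directions, composed with \<open>f\<close>; the induction
  hypothesis covers these because it holds for every outer map.\<close>

lemma Ck_on_compose:
  fixes f :: "'a::euclidean_space \<Rightarrow> 'b::euclidean_space" and g :: "'b \<Rightarrow> 'c::euclidean_space"
  assumes "open S" "Ck_on k S f" "Ck_on k T g" "f ` S \<subseteq> T"
  shows "Ck_on k S (\<lambda>x. g (f x))"
  using assms(2-)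
proof (induction k arbitrary: g)
  case 0
  then show ?case using continuous_on_compose2[of T g S f] by simp
next
  case (Suc k)
  show ?case
  proof (rule Ck_on_SucI[OF assms(1)])
    fix x assume x: "x \<in> S"
    have g: "(g has_derivative frechet_derivative g (at (f x))) (at (f x))"
      using Ck_on_has_derivative[OF Suc.prems(2)] Suc.prems(3) x by blast
    have "((\<lambda>x. g (f x)) has_derivative (\<lambda>v. frechet_derivative g (at (f x)) (frechet_derivative f (at x) v))) (at x)"
      using has_derivative_compose[OF Ck_on_has_derivative[OF Suc.prems(1) x] g] .
    also have "(\<lambda>v. frechet_derivative g (at (f x)) (frechet_derivative f (at x) v)) =
       (\<lambda>v. \<Sum>b\<in>Basis. (frechet_derivative f (at x) v \<bullet> b) *\<^sub>R frechet_derivative g (at (f x)) b)"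
      using has_derivative_bounded_linear[OF g]
      by (subst euclidean_representation[symmetric])
        (simp add: linear_sum linear_scale bounded_linear.linear del: euclidean_representation)
    finally show "((\<lambda>x. g (f x)) has_derivative
      (\<lambda>v. \<Sum>b\<in>Basis. (frechet_derivative f (at x) v \<bullet> b) *\<^sub>R frechet_derivative g (at (f x)) b)) (at x)" .
  next
    fix v
    have 1: "Ck_on k S (\<lambda>x. frechet_derivative g (at (f x)) b)" for b
      by (rule Suc.IH[OF Ck_on_SucD[OF Suc.prems(1)] Ck_on_frechet_derivative[OF Suc.prems(2)] Suc.prems(3)])
    have 2: "Ck_on k S (\<lambda>x. frechet_derivative f (at x) v \<bullet> b)" for b
      by (rule Ck_on_linear_compose[OF bounded_linear.linear[OF bounded_linear_inner_left] assms(1)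
          Ck_on_frechet_derivative[OF Suc.prems(1)]])
    show "Ck_on k S (\<lambda>x. \<Sum>b\<in>Basis. (frechet_derivative f (at x) v \<bullet> b) *\<^sub>R frechet_derivative g (at (f x)) b)"
      by (intro Ck_on_sum[OF assms(1)] Ck_on_bilinear[OF bounded_bilinear_scaleR assms(1)] 1 2)
  qed
qed

section \<open>Smoothness of all orders\<close>

lemma smooth_on_cong:
  assumes "open S" "\<And>x. x \<in> S \<Longrightarrow> f x = g x"
  shows "smooth_on S f \<longleftrightarrow> smooth_on S g"
  using Ck_on_cong[OF assms] by (simp add: smooth_on_def)

lemma smooth_on_subset: "smooth_on S f \<Longrightarrow> T \<subseteq> S \<Longrightarrow> smooth_on T f"
  by (auto simp: smooth_on_def intro: Ck_on_subset)

lemma smooth_on_local: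
  assumes "\<And>x. x \<in> S \<Longrightarrow> \<exists>T. open T \<and> x \<in> T \<and> smooth_on T f"
  shows "smooth_on S f"
  unfolding smooth_on_def
  by (intro allI Ck_on_local) (use assms in \<open>force simp: smooth_on_def\<close>)

lemma smooth_on_has_derivative:
  "smooth_on S f \<Longrightarrow> x \<in> S \<Longrightarrow> (f has_derivative frechet_derivative f (at x)) (at x)"
  unfolding smooth_on_def using Ck_on_has_derivative by blast

lemma smooth_on_linear_derivative: "smooth_on S f \<Longrightarrow> x \<in> S \<Longrightarrow> linear (frechet_derivative f (at x))"
  using smooth_on_has_derivative has_derivative_bounded_linear bounded_linear.linear by blast

lemma smooth_on_imp_continuous_on: "smooth_on S f \<Longrightarrow> continuous_on S f"
  unfolding smooth_on_def by (metis Ck_on.simps(1))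

lemma smooth_on_frechet_derivative:
  "smooth_on S f \<Longrightarrow> smooth_on S (\<lambda>x. frechet_derivative f (at x) v)"
  unfolding smooth_on_def by (metis Ck_on.simps(2))

lemma smooth_on_const: "smooth_on S (\<lambda>x. c)"
  by (simp add: smooth_on_def Ck_on_const)

lemma smooth_on_linear: "linear f \<Longrightarrow> smooth_on S f"
  by (simp add: smooth_on_def Ck_on_linear)

lemma smooth_on_id: "smooth_on S (\<lambda>x. x)"
  by (rule smooth_on_linear) (rule module_hom_ident)

lemma smooth_on_add: "open S \<Longrightarrow> smooth_on S f \<Longrightarrow> smooth_on S g \<Longrightarrow> smooth_on S (\<lambda>x. f x + g x)"
  by (simp add: smooth_on_def Ck_on_add)

lemma smooth_on_sum:
  "open S \<Longrightarrow> (\<And>i. i \<in> I \<Longrightarrow> smooth_on S (f i)) \<Longrightarrow> smooth_on S (\<lambda>x. \<Sum>i\<in>I. f i x)"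
  by (simp add: smooth_on_def Ck_on_sum)

lemma smooth_on_scaleR:
  "open S \<Longrightarrow> smooth_on S f \<Longrightarrow> smooth_on S g \<Longrightarrow> smooth_on S (\<lambda>x. f x *\<^sub>R g x)"
  by (simp add: smooth_on_def Ck_on_bilinear[OF bounded_bilinear_scaleR])

lemma smooth_on_linear_compose:
  "linear L \<Longrightarrow> open S \<Longrightarrow> smooth_on S f \<Longrightarrow> smooth_on S (\<lambda>x. L (f x))"
  by (simp add: smooth_on_def Ck_on_linear_compose)

lemma smooth_on_inner_right: "open S \<Longrightarrow> smooth_on S f \<Longrightarrow> smooth_on S (\<lambda>x. f x \<bullet> b)"
  by (rule smooth_on_linear_compose[OF bounded_linear.linear[OF bounded_linear_inner_left]])

lemma smooth_on_compose:
  "open S \<Longrightarrow> smooth_on S f \<Longrightarrow> smooth_on T g \<Longrightarrow> f ` S \<subseteq> T \<Longrightarrow> smooth_on S (\<lambda>x. g (f x))"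
  unfolding smooth_on_def using Ck_on_compose by blast

lemma smooth_on_fst: "open S \<Longrightarrow> smooth_on S f \<Longrightarrow> smooth_on S (\<lambda>x. fst (f x))"
  by (rule smooth_on_linear_compose[OF bounded_linear.linear[OF bounded_linear_fst]])

lemma smooth_on_snd: "open S \<Longrightarrow> smooth_on S f \<Longrightarrow> smooth_on S (\<lambda>x. snd (f x))"
  by (rule smooth_on_linear_compose[OF bounded_linear.linear[OF bounded_linear_snd]])

text \<open>A pair is the sum of two linear embeddings, which reduces the claim to addition and
  linear maps.\<close>

lemma smooth_on_Pair:
  assumes "open S" "smooth_on S f" "smooth_on S g"
  shows "smooth_on S (\<lambda>x. (f x, g x))"
proof -
  have "smooth_on S (\<lambda>x. (f x, 0))" "smooth_on S (\<lambda>x. (0, g x))"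
    by (rule smooth_on_linear_compose[OF _ assms(1,2)] smooth_on_linear_compose[OF _ assms(1,3)],
        rule linearI, simp_all)+
  from smooth_on_add[OF assms(1) this] show ?thesis by simp
qed

section \<open>Linear families and linear systems with smooth coefficients\<close>

lemma linear_euclidean_expansion:
  assumes "linear L" shows "L v = (\<Sum>b\<in>Basis. (v \<bullet> b) *\<^sub>R L b)"
proof -
  have "L v = L (\<Sum>b\<in>Basis. (v \<bullet> b) *\<^sub>R b)" by (simp add: euclidean_representation)
  also have "\<dots> = (\<Sum>b\<in>Basis. (v \<bullet> b) *\<^sub>R L b)"
    using assms by (simp add: linear_sum linear_scale)
  finally show ?thesis .
qed

text \<open>Stands in for smoothness of \<open>M\<close> as a map into a space of linear maps:
  expanding \<open>v z\<close> in the basis reduces everything to fixed vectors.\<close>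

lemma smooth_on_linear_family:
  assumes "open S" "\<And>z. z \<in> S \<Longrightarrow> linear (M z)" "\<And>b. smooth_on S (\<lambda>z. M z b)" "smooth_on S v"
  shows "smooth_on S (\<lambda>z. M z (v z))"
proof -
  have "smooth_on S (\<lambda>z. \<Sum>b\<in>Basis. (v z \<bullet> b) *\<^sub>R M z b)"
    using assms by (intro smooth_on_sum smooth_on_scaleR smooth_on_inner_right) auto
  then show ?thesis
    by (rule smooth_on_cong[OF assms(1), THEN iffD2, rotated]) (rule linear_euclidean_expansion[OF assms(2)])
qed

text \<open>If \<open>A x\<close> is invertible, then \<open>\<bar>A y c\<bar> \<ge> m \<bar>c\<bar>\<close> holds with a uniform \<open>m > 0\<close> near \<open>x\<close>; applied to
  \<open>c = d y - d x\<close> this gives continuity of the solution \<open>d\<close> of \<open>A y (d y) = b y\<close>.\<close>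

lemma continuous_on_linear_solution:
  fixes A :: "'e::euclidean_space \<Rightarrow> 'f::euclidean_space \<Rightarrow> 'f"
  assumes "open S" and lin: "\<And>x. x \<in> S \<Longrightarrow> linear (A x)" and inj: "\<And>x. x \<in> S \<Longrightarrow> inj (A x)"
    and cA: "\<And>c. continuous_on S (\<lambda>x. A x c)" and cb: "continuous_on S b"
    and sol: "\<And>x. x \<in> S \<Longrightarrow> A x (d x) = b x"
  shows "continuous_on S d"
proof -
  have "(d \<longlongrightarrow> d x) (at x)" if x: "x \<in> S" for x
  proof -
    obtain m where m: "m > 0" "\<And>c. m * norm c \<le> norm (A x c)"
      using linear_inj_bounded_below_pos[OF lin[OF x] inj[OF x]] by (metis mult.commute)
    have tA: "((\<lambda>y. A y c) \<longlongrightarrow> A x c) (at x)" for c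
      using cA[of c] x assms(1) by (simp add: continuous_on_eq_continuous_at isCont_def)
    have tb: "(b \<longlongrightarrow> b x) (at x)"
      using cb x assms(1) by (simp add: continuous_on_eq_continuous_at isCont_def)
    \<comment> \<open>\<open>e y\<close> bounds the operator norm of \<open>A y - A x\<close>,
      because coordinates are bounded by the norm. Once it is below \<open>m / 2\<close>, the lower
      bound \<open>m\<close> for \<open>A x\<close> leaves \<open>m / 2\<close> for
      \<open>A y\<close>.\<close>
    define e where "e y = (\<Sum>c\<in>Basis. norm (A y c - A x c))" for y
    have "(e \<longlongrightarrow> (\<Sum>c\<in>(Basis :: 'f set). norm (A x c - A x c))) (at x)"
      unfolding e_def by (intro tendsto_intros tA)
    then have "(e \<longlongrightarrow> 0) (at x)" by simp
    then have "\<forall>\<^sub>F y in at x. e y < m / 2" using m(1) by (intro order_tendstoD) auto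
    moreover have "\<forall>\<^sub>F y in at x. y \<in> S" using assms(1) x by (simp add: eventually_at_in_open')
    ultimately have "\<forall>\<^sub>F y in at x. norm (d y - d x) \<le> (2 / m) * norm (b y - A y (d x))"
    proof eventually_elim
      case (elim y)
      let ?c = "d y - d x"
      have "A y ?c - A x ?c = (\<Sum>i\<in>Basis. (?c \<bullet> i) *\<^sub>R (A y i - A x i))"
        by (simp add: linear_euclidean_expansion[OF lin[OF elim(2)], of ?c]
            linear_euclidean_expansion[OF lin[OF x], of ?c] sum_subtractf[symmetric] scaleR_diff_right)
      also have "norm \<dots> \<le> (\<Sum>i\<in>Basis. norm ?c * norm (A y i - A x i))"
        by (rule sum_norm_le) (simp add: Basis_le_norm mult_right_mono)
      also have "\<dots> = norm ?c * e y" by (simp add: e_def sum_distrib_left)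
      also have "\<dots> \<le> norm ?c * (m / 2)" using elim(1) by (intro mult_left_mono) auto
      finally have "norm (A y ?c - A x ?c) \<le> norm ?c * (m / 2)" .
      moreover have "norm (A x ?c) \<le> norm (A y ?c) + norm (A y ?c - A x ?c)"
        by (metis norm_minus_commute norm_triangle_sub)
      ultimately have "norm ?c * (m / 2) \<le> norm (A y ?c)"
        using m(2)[of ?c] by (simp add: algebra_simps)
      also have "A y ?c = b y - A y (d x)"
        using lin[OF elim(2)] sol[OF elim(2)] by (simp add: linear_diff)
      finally show ?case using m(1) by (simp add: field_simps)
    qed
    moreover have "((\<lambda>y. (2 / m) * norm (b y - A y (d x))) \<longlongrightarrow> (2 / m) * norm (b x - A x (d x))) (at x)"
      by (intro tendsto_intros tA tb)
    ultimately have "((\<lambda>y. d y - d x) \<longlongrightarrow> 0) (at x)"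
      using sol[OF x] by (auto intro: Lim_null_comparison)
    then show ?thesis by (simp add: LIM_zero_iff)
  qed
  then show ?thesis
    by (simp add: continuous_at_imp_continuous_on isCont_def)
qed

text \<open>The derivative of \<open>(x, b) \<mapsto> A x\<^sup>-\<^sup>1 b\<close> is obtained from that of the inverse map
  \<open>(x, c) \<mapsto> (x, A x c)\<close>; differentiating \<open>A x (d x) = b x\<close> once shows that the derivatives of the
  solution solve a linear system with the same matrix, which gives the induction on the order.\<close>

lemma Ck_on_linear_solution:
  fixes A :: "'e::euclidean_space \<Rightarrow> 'f::euclidean_space \<Rightarrow> 'f"
  assumes S: "open S" and lin: "\<And>x. x \<in> S \<Longrightarrow> linear (A x)" and inj: "\<And>x. x \<in> S \<Longrightarrow> inj (A x)"
    and A: "\<And>c. smooth_on S (\<lambda>x. A x c)" and "Ck_on k S b"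
    and "\<And>x. x \<in> S \<Longrightarrow> A x (d x) = b x"
  shows "Ck_on k S d"
  using assms(5,6)
proof (induction k arbitrary: b d)
  case 0
  then show ?case
    using continuous_on_linear_solution[OF S lin inj, where b = b and d = d] smooth_on_imp_continuous_on[OF A] by simp
next
  case (Suc k)
  define B where "B x = inv (A x)" for x
  have bij: "bij (A x)" if "x \<in> S" for x
    using linear_injective_imp_surjective[OF lin[OF that] inj[OF that]] inj[OF that] by (simp add: bij_def)
  have AB: "A x (B x c) = c" and BA: "B x (A x c) = c" if "x \<in> S" for x c
    using bij[OF that] by (simp_all add: B_def bij_is_surj surj_f_inv_f bij_is_inj)
  have linB: "linear (B x)" if "x \<in> S" for x
  proof (rule linearI)
    show "B x (c + c') = B x c + B x c'" for c c'
      using BA[OF that, of "B x c + B x c'"] AB[OF that] by (simp add: linear_add[OF lin[OF that]])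
    show "B x (r *\<^sub>R c) = r *\<^sub>R B x c" for r c
      using BA[OF that, of "r *\<^sub>R B x c"] AB[OF that] by (simp add: linear_scale[OF lin[OF that]])
  qed
  have dB: "d x = B x (b x)" if "x \<in> S" for x
    using Suc.prems(2)[OF that] BA[OF that] by metis
  \<comment> \<open>\<open>?A' x c v\<close> is the derivative of \<open>A\<close> in direction
    \<open>v\<close>, applied to \<open>c\<close>. Differentiating \<open>A x (d x) = b x\<close>
    shows that \<open>?b' x v\<close> is what \<open>A x\<close> maps the derivative of
    \<open>d\<close> to.\<close>
  let ?A' = "\<lambda>x c v. \<Sum>i\<in>Basis. (c \<bullet> i) *\<^sub>R frechet_derivative (\<lambda>y. A y i) (at x) v"
  let ?b' = "\<lambda>x v. frechet_derivative b (at x) v - ?A' x (d x) v"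
  \<comment> \<open>The inverse function rule \<open>has_derivative_inverse_basic\<close>
    presupposes a continuous inverse. Its continuity is the order-zero lemma over the parameter
    space \<open>S \<times> UNIV\<close>, with the right-hand side as second parameter.\<close>
  have "continuous_on (S \<times> UNIV) (\<lambda>p. B (fst p) (snd p))"
  proof (rule continuous_on_linear_solution[where b = snd and A = "\<lambda>p. A (fst p)"])
    show "continuous_on (S \<times> UNIV) (\<lambda>x. A (fst x) c)" for c
      by (rule continuous_on_compose2[OF smooth_on_imp_continuous_on[OF A]]) (auto intro: continuous_intros)
  qed (use lin inj AB S in \<open>auto intro: open_Times continuous_intros\<close>)
  then have contB: "continuous (at p) (\<lambda>p. B (fst p) (snd p))" if "fst p \<in> S" for p
    using that S by (cases p) (simp add: continuous_on_eq_continuous_at open_Times)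
  show ?case
  proof (rule Ck_on_SucI[OF S])
    fix x assume x: "x \<in> S"
    let ?f = "\<lambda>p. (fst p, A (fst p) (snd p))"
    let ?g = "\<lambda>p. (fst p, B (fst p) (snd p))"
    \<comment> \<open>Differentiability is available for \<open>A y i\<close> with \<open>i\<close>
      fixed, so the second argument is first expanded in the basis.\<close>
    have "((\<lambda>p. (fst p, \<Sum>i\<in>Basis. (snd p \<bullet> i) *\<^sub>R A (fst p) i)) has_derivative
       (\<lambda>p. (fst p, \<Sum>i\<in>Basis. (d x \<bullet> i) *\<^sub>R frechet_derivative (\<lambda>y. A y i) (at x) (fst p) + (snd p \<bullet> i) *\<^sub>R A x i)))
       (at (x, d x))"
      by (rule has_derivative_eq_rhs)
        (rule derivative_intros has_derivative_compose[OF has_derivative_fst[OF has_derivative_ident]]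
            smooth_on_has_derivative[OF A] | simp add: x)+
    also have "(\<lambda>p. (fst p, \<Sum>i\<in>Basis. (d x \<bullet> i) *\<^sub>R frechet_derivative (\<lambda>y. A y i) (at x) (fst p) + (snd p \<bullet> i) *\<^sub>R A x i)) =
        (\<lambda>p. (fst p, ?A' x (d x) (fst p) + A x (snd p)))"
      by (auto simp: sum.distrib linear_euclidean_expansion[OF lin[OF x], symmetric])
    finally have "(?f has_derivative (\<lambda>p. (fst p, ?A' x (d x) (fst p) + A x (snd p)))) (at (x, d x))"
      by (subst has_derivative_cong_open[where S = "S \<times> UNIV" and g = "\<lambda>p. (fst p, \<Sum>i\<in>Basis. (snd p \<bullet> i) *\<^sub>R A (fst p) i)"])
        (use S x linear_euclidean_expansion[OF lin] in \<open>auto intro!: open_Times\<close>)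
    then have f: "(?f has_derivative (\<lambda>p. (fst p, ?A' x (d x) (fst p) + A x (snd p)))) (at (?g (x, b x)))"
      using dB[OF x] by simp
    have linA': "linear (?A' x c)" for c
      by (intro linear_compose_sum ballI linear_compose_scale_right smooth_on_linear_derivative[OF A x])
    have "linear (\<lambda>p. (fst p, B x (snd p - ?A' x (d x) (fst p))))"
      by (intro linearI) (simp_all add: linear_add[OF linA'] linear_scale[OF linA'] linear_diff[OF linB[OF x]]
        linear_add[OF linB[OF x]] linear_scale[OF linB[OF x]] algebra_simps)
    then have blin: "bounded_linear (\<lambda>p. (fst p, B x (snd p - ?A' x (d x) (fst p))))"
      by (simp add: linear_conv_bounded_linear)
    have "(?g has_derivative (\<lambda>p. (fst p, B x (snd p - ?A' x (d x) (fst p))))) (at (x, b x))"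
    proof (rule has_derivative_inverse_basic[where g = ?g and f = ?f and T = "S \<times> UNIV", OF f blin])
      show "continuous (at (x, b x)) ?g"
        by (intro continuous_intros contB) (use x in auto)
    qed (use S x AB BA in \<open>auto simp: open_Times fun_eq_iff\<close>)
    \<comment> \<open>Since \<open>d y = B y (b y)\<close>, the map \<open>d\<close> is the second
      component of \<open>?g\<close> after \<open>y \<mapsto> (y, b y)\<close>.\<close>
    from has_derivative_compose[OF has_derivative_Pair[OF has_derivative_ident Ck_on_has_derivative[OF Suc.prems(1) x]] this]
    have "((\<lambda>y. snd (y, B y (b y))) has_derivative (\<lambda>v. snd (v, B x (?b' x v)))) (at x)"
      by (intro has_derivative_snd) simp
    then show "(d has_derivative (\<lambda>v. B x (?b' x v))) (at x)"
      by (subst has_derivative_cong_open[OF S x, of d "\<lambda>y. snd (y, B y (b y))"]) (use dB in auto)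
  next
    fix v
    \<comment> \<open>The right-hand side \<open>?b'\<close> contains \<open>d\<close> itself. The
      induction hypothesis is therefore used twice: first for \<open>d\<close> at order
      \<open>k\<close>, then for its derivative.\<close>
    have d: "Ck_on k S d" using Suc.IH[OF Ck_on_SucD[OF Suc.prems(1)]] Suc.prems(2) by auto
    have A': "Ck_on k S (\<lambda>x. ?A' x (d x) v)"
      by (intro Ck_on_sum[OF S] Ck_on_bilinear[OF bounded_bilinear_scaleR S]
          Ck_on_linear_compose[OF _ S d] bounded_linear.linear[OF bounded_linear_inner_left])
        (use smooth_on_frechet_derivative[OF A] in \<open>simp add: smooth_on_def\<close>)
    have "Ck_on k S (\<lambda>x. frechet_derivative b (at x) v + (- 1) *\<^sub>R ?A' x (d x) v)"
      by (rule Ck_on_add[OF S Ck_on_frechet_derivative[OF Suc.prems(1)]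
            Ck_on_linear_compose[OF linear_scaleR[of "- 1"] S A']])
    then have "Ck_on k S (\<lambda>x. ?b' x v)" by simp
    then show "Ck_on k S (\<lambda>x. B x (?b' x v))"
      by (rule Suc.IH[where b = "\<lambda>x. ?b' x v"]) (rule AB)
  qed
qed

lemma smooth_on_linear_solution:
  fixes A :: "'e::euclidean_space \<Rightarrow> 'f::euclidean_space \<Rightarrow> 'f"
  assumes "open S" "\<And>x. x \<in> S \<Longrightarrow> linear (A x)" "\<And>x. x \<in> S \<Longrightarrow> inj (A x)"
    "\<And>c. smooth_on S (\<lambda>x. A x c)" "smooth_on S b" "\<And>x. x \<in> S \<Longrightarrow> A x (d x) = b x"
  shows "smooth_on S d"
  using Ck_on_linear_solution[OF assms(1-4) _ assms(6)] assms(5) by (simp add: smooth_on_def)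

section \<open>Smooth atlases and smooth maps\<close>

text \<open>The chart conditions of \<open>smooth_manifold\<close>, separated from its topological
  axioms. They pass to tangent atlases and products by local computation, whereas Hausdorffness and
  second countability are global and are treated once, for the distribution.\<close>

definition smooth_atlas :: "('a, 'e::euclidean_space) chart set \<Rightarrow> bool" where
  "smooth_atlas A \<longleftrightarrow>
     (\<forall>c\<in>A. inj_on (snd c) (fst c) \<and> open (snd c ` fst c)) \<and>
     (\<forall>c\<in>A. \<forall>d\<in>A. open (snd c ` (fst c \<inter> fst d)) \<and>
        smooth_on (snd c ` (fst c \<inter> fst d)) (local_rep c d id))"

lemma smooth_manifold_iff:
  "smooth_manifold A \<longleftrightarrow>
     smooth_atlas A \<and> Hausdorff_space (atlas_topology A) \<and> second_countable (atlas_topology A)"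
  unfolding smooth_manifold_def smooth_atlas_def case_prod_beta prod.collapse by blast

lemma smooth_atlas_inj: "smooth_atlas A \<Longrightarrow> c \<in> A \<Longrightarrow> inj_on (snd c) (fst c)"
  by (simp add: smooth_atlas_def)

lemma smooth_atlas_transition:
  assumes "smooth_atlas A" "c \<in> A" "d \<in> A"
  shows "open (snd c ` (fst c \<inter> fst d))" "smooth_on (snd c ` (fst c \<inter> fst d)) (local_rep c d id)"
  using assms unfolding smooth_atlas_def by blast+

lemma chart_inv_eq: "smooth_atlas A \<Longrightarrow> c \<in> A \<Longrightarrow> p \<in> fst c \<Longrightarrow> chart_inv c (snd c p) = p"
  by (simp add: chart_inv_def smooth_atlas_inj)

lemma local_rep_eq:
  "smooth_atlas A \<Longrightarrow> c \<in> A \<Longrightarrow> p \<in> fst c \<Longrightarrow> local_rep c d f (snd c p) = snd d (f p)"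
  by (simp add: local_rep_def chart_inv_eq)

section \<open>The topology defined by an atlas\<close>

lemma openin_atlas:
  assumes "smooth_atlas A"
  shows "openin (atlas_topology A) W \<longleftrightarrow> W \<subseteq> points A \<and> (\<forall>c\<in>A. open (snd c ` (W \<inter> fst c)))"
proof -
  let ?L = "\<lambda>W. W \<subseteq> points A \<and> (\<forall>c\<in>A. open (snd c ` (W \<inter> fst c)))"
  \<comment> \<open>The constructor \<open>topology\<close> can be unfolded only after this.
    Injectivity of the charts enters for intersections, whose images must be the intersections of
    the images.\<close>
  have "istopology ?L"
    unfolding istopology_def
  proof (intro conjI allI impI)
    fix S T assume S: "?L S" and T: "?L T"
    show "S \<inter> T \<subseteq> points A" using S by blast
    have "snd c ` (S \<inter> T \<inter> fst c) = snd c ` (S \<inter> fst c) \<inter> snd c ` (T \<inter> fst c)" if "c \<in> A" for c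
      using smooth_atlas_inj[OF assms that] by (auto simp: inj_on_def)
    then show "\<forall>c\<in>A. open (snd c ` (S \<inter> T \<inter> fst c))"
      using S T by (simp add: open_Int)
  next
    fix K assume K: "\<forall>S\<in>K. ?L S"
    show "\<Union>K \<subseteq> points A" using K by blast
    show "\<forall>c\<in>A. open (snd c ` (\<Union>K \<inter> fst c))"
    proof
      fix c assume "c \<in> A"
      have "snd c ` (\<Union>K \<inter> fst c) = (\<Union>S\<in>K. snd c ` (S \<inter> fst c))" by auto
      then show "open (snd c ` (\<Union>K \<inter> fst c))" using K \<open>c \<in> A\<close> by (auto intro!: open_UN)
    qed
  qed
  then show ?thesis
    unfolding atlas_topology_def by (simp add: topology_inverse' case_prod_beta)
qed

lemma openin_fst_chart:
  assumes "smooth_atlas A" "c \<in> A"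
  shows "openin (atlas_topology A) (fst c)"
proof -
  have "open (snd d ` (fst c \<inter> fst d))" if "d \<in> A" for d
    using assms that by (simp add: smooth_atlas_def Int_commute[of "fst c"])
  then show ?thesis using assms by (auto simp: openin_atlas points_def)
qed

lemma topspace_atlas:
  assumes "smooth_atlas A" shows "topspace (atlas_topology A) = points A"
proof
  show "topspace (atlas_topology A) \<subseteq> points A"
    using openin_topspace[of "atlas_topology A"] unfolding openin_atlas[OF assms] by blast
  show "points A \<subseteq> topspace (atlas_topology A)"
    using openin_subset[OF openin_fst_chart[OF assms]] by (auto simp: points_def)
qed

lemma open_chart_image:
  "smooth_atlas A \<Longrightarrow> c \<in> A \<Longrightarrow> openin (atlas_topology A) W \<Longrightarrow> W \<subseteq> fst c \<Longrightarrow> open (snd c ` W)"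
  using openin_atlas[of A W] by (metis inf.orderE)

lemma open_preimage_continuous:
  assumes "continuous_on S f" "open S" "open T"
  shows "open {x \<in> S. f x \<in> T}"
  using continuous_open_preimage[OF assms] by (simp add: vimage_def Int_def)

text \<open>Seen in another chart \<open>d\<close>, the set is the preimage of \<open>V\<close>
  under the transition map.\<close>

lemma openin_chart_vimage:
  assumes A: "smooth_atlas A" "c \<in> A" and V: "open V"
  shows "openin (atlas_topology A) {p \<in> fst c. snd c p \<in> V}"
  unfolding openin_atlas[OF A(1)]
proof (intro conjI ballI)
  show "{p \<in> fst c. snd c p \<in> V} \<subseteq> points A" using A(2) by (auto simp: points_def)
  fix d assume d: "d \<in> A"
  have "snd d ` ({p \<in> fst c. snd c p \<in> V} \<inter> fst d) =
      {x \<in> snd d ` (fst d \<inter> fst c). local_rep d c id x \<in> V}"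
    using A d by (auto simp: local_rep_eq)
  also have "open \<dots>"
    by (rule open_preimage_continuous[OF smooth_on_imp_continuous_on])
      (use smooth_atlas_transition[OF A(1) d A(2)] V in auto)
  finally show "open (snd d ` ({p \<in> fst c. snd c p \<in> V} \<inter> fst d))" .
qed

text \<open>Injectivity of both charts turns the set into the preimage under \<open>c\<close> of an
  open subset of the model space, so continuity in one pair of charts becomes continuity for the
  atlas topologies.\<close>

lemma openin_vimage_local_rep:
  assumes A: "smooth_atlas A" "c \<in> A" and B: "smooth_atlas B" "d \<in> B"
    and W: "openin (atlas_topology A) W" "W \<subseteq> fst c" "f ` W \<subseteq> fst d"
    and f: "continuous_on (snd c ` W) (local_rep c d f)"
    and V: "openin (atlas_topology B) V"
  shows "openin (atlas_topology A) {q \<in> W. f q \<in> V}"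
proof -
  have 1: "open (snd d ` (V \<inter> fst d))" using V B by (simp add: openin_atlas)
  have "{q \<in> W. f q \<in> V} = {q \<in> fst c. snd c q \<in> {x \<in> snd c ` W. local_rep c d f x \<in> snd d ` (V \<inter> fst d)}}"
    (is "?L = ?R")
  proof
    show "?L \<subseteq> ?R"
    proof
      fix q assume "q \<in> ?L"
      then have q: "q \<in> fst c" "q \<in> W" "f q \<in> V" "f q \<in> fst d" using W by auto
      then show "q \<in> ?R" using local_rep_eq[OF A q(1), of d f] by auto
    qed
    show "?R \<subseteq> ?L"
    proof
      fix q assume "q \<in> ?R"
      then have q: "q \<in> fst c" "snd c q \<in> snd c ` W" "local_rep c d f (snd c q) \<in> snd d ` (V \<inter> fst d)" by auto
      then have qW: "q \<in> W" using smooth_atlas_inj[OF A] W(2) by (metis inj_on_image_mem_iff)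
      then have "f q \<in> fst d" using W(3) by auto
      moreover have "snd d (f q) \<in> snd d ` (V \<inter> fst d)" using q local_rep_eq[OF A q(1), of d f] by simp
      ultimately have "f q \<in> V" using smooth_atlas_inj[OF B] by (metis Int_iff inf_le2 inj_on_image_mem_iff)
      then show "q \<in> ?L" using qW by simp
    qed
  qed
  then show ?thesis
    using openin_chart_vimage[OF A open_preimage_continuous[OF f open_chart_image[OF A W(1,2)] 1]] by simp
qed

text \<open>One pair of charts and one neighbourhood suffice here, against all pairs in
  \<open>smooth_map\<close>. This makes smoothness easy to establish, and
  \<open>smooth_near_charts\<close> recovers every other pair.\<close>

definition smooth_near ::
  "('a, 'e::euclidean_space) chart set \<Rightarrow> ('b, 'f::euclidean_space) chart set \<Rightarrow> ('a \<Rightarrow> 'b) \<Rightarrow> 'a \<Rightarrow> bool" where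
  "smooth_near A B f p \<longleftrightarrow> (\<exists>c\<in>A. \<exists>d\<in>B. \<exists>W. openin (atlas_topology A) W \<and> p \<in> W \<and> W \<subseteq> fst c \<and>
     f ` W \<subseteq> fst d \<and> smooth_on (snd c ` W) (local_rep c d f))"

lemma smooth_nearI:
  "\<lbrakk>c \<in> A; d \<in> B; openin (atlas_topology A) W; p \<in> W; W \<subseteq> fst c; f ` W \<subseteq> fst d;
    smooth_on (snd c ` W) (local_rep c d f)\<rbrakk> \<Longrightarrow> smooth_near A B f p"
  unfolding smooth_near_def by blast

lemma smooth_nearE:
  assumes "smooth_near A B f p"
  obtains c d W where "c \<in> A" "d \<in> B" "openin (atlas_topology A) W" "p \<in> W" "W \<subseteq> fst c"
    "f ` W \<subseteq> fst d" "smooth_on (snd c ` W) (local_rep c d f)"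
  using assms unfolding smooth_near_def by blast

text \<open>Two local representations differ by transition maps on either side. The neighbourhood
  shrinks until both pairs of charts apply; the shrunken set is open by continuity of
  \<open>f\<close>.\<close>

lemma smooth_near_charts:
  assumes A: "smooth_atlas A" and B: "smooth_atlas B" and f: "smooth_near A B f p"
    and c': "c' \<in> A" "p \<in> fst c'" and d': "d' \<in> B" "f p \<in> fst d'"
  obtains W where "openin (atlas_topology A) W" "p \<in> W" "W \<subseteq> fst c'" "f ` W \<subseteq> fst d'"
    "smooth_on (snd c' ` W) (local_rep c' d' f)"
proof -
  obtain c d W where c: "c \<in> A" and d: "d \<in> B"
    and W: "openin (atlas_topology A) W" "p \<in> W" "W \<subseteq> fst c" "f ` W \<subseteq> fst d"
    and sm: "smooth_on (snd c ` W) (local_rep c d f)"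
    using f by (rule smooth_nearE)
  define W' where "W' = {q \<in> W. f q \<in> fst d'} \<inter> fst c'"
  have oW': "openin (atlas_topology A) W'"
    unfolding W'_def
    by (intro openin_Int openin_vimage_local_rep[OF A c B d W(1,3,4) smooth_on_imp_continuous_on[OF sm]]
        openin_fst_chart A B c' d')
  have sub: "W' \<subseteq> W" "W' \<subseteq> fst c'" "f ` W' \<subseteq> fst d'" by (auto simp: W'_def)
  have o: "open (snd c' ` W')" by (rule open_chart_image[OF A c'(1) oW' sub(2)])
  have "smooth_on (snd c' ` W') (\<lambda>x. local_rep d d' id (local_rep c d f (local_rep c' c id x)))"
  proof (rule smooth_on_compose[where g = "local_rep d d' id" and f = "\<lambda>x. local_rep c d f (local_rep c' c id x)", OF o])
    show "smooth_on (snd c' ` W') (\<lambda>x. local_rep c d f (local_rep c' c id x))"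
    proof (rule smooth_on_compose[OF o _ sm])
      show "smooth_on (snd c' ` W') (local_rep c' c id)"
        by (rule smooth_on_subset[OF smooth_atlas_transition(2)[OF A c'(1) c]])
          (use sub W in blast)
      show "local_rep c' c id ` (snd c' ` W') \<subseteq> snd c ` W"
        using sub(1) by (auto simp: local_rep_eq[OF A c'(1) subsetD[OF sub(2)]])
    qed
    show "smooth_on (snd d ` (fst d \<inter> fst d')) (local_rep d d' id)"
      by (rule smooth_atlas_transition(2)[OF B d d'(1)])
    show "(\<lambda>x. local_rep c d f (local_rep c' c id x)) ` snd c' ` W' \<subseteq> snd d ` (fst d \<inter> fst d')"
    proof clarify
      fix q assume q: "q \<in> W'"
      then have "q \<in> fst c" "q \<in> fst c'" "f q \<in> fst d \<inter> fst d'" using sub W by blast+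
      then show "local_rep c d f (local_rep c' c id (snd c' q)) \<in> snd d ` (fst d \<inter> fst d')"
        by (simp add: local_rep_eq[OF A c'(1)] local_rep_eq[OF A c])
    qed
  qed
  then have "smooth_on (snd c' ` W') (local_rep c' d' f)"
  proof (rule smooth_on_cong[OF o, THEN iffD2, rotated])
    fix x assume "x \<in> snd c' ` W'"
    then obtain q where q: "q \<in> W'" "x = snd c' q" by blast
    then have "q \<in> fst c" "q \<in> fst c'" "f q \<in> fst d" using sub W by blast+
    then show "local_rep c' d' f x = local_rep d d' id (local_rep c d f (local_rep c' c id x))"
      using q by (simp add: local_rep_eq[OF A c'(1)] local_rep_eq[OF A c] local_rep_eq[OF B d])
  qed
  then show ?thesis
    using that[OF oW' _ sub(2,3)] W(2) c' d' by (simp add: W'_def)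
qed

lemma smooth_near_points:
  assumes "smooth_near A B f p" shows "p \<in> points A" "f p \<in> points B"
  using assms by (auto simp: smooth_near_def points_def)

text \<open>Makes smoothness a pointwise condition, which can be composed and paired without
  computing domains in every pair of charts.\<close>

lemma smooth_map_iff:
  assumes A: "smooth_atlas A" and B: "smooth_atlas B"
  shows "smooth_map A B W f \<longleftrightarrow> openin (atlas_topology A) W \<and> (\<forall>p\<in>W. smooth_near A B f p)"
proof
  assume "smooth_map A B W f"
  then have W: "openin (atlas_topology A) W" "f ` W \<subseteq> points B"
    and *: "\<And>c d. c \<in> A \<Longrightarrow> d \<in> B \<Longrightarrow> open (snd c ` (fst c \<inter> W \<inter> f -` fst d)) \<and>
        smooth_on (snd c ` (fst c \<inter> W \<inter> f -` fst d)) (local_rep c d f)"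
    unfolding smooth_map_def case_prod_beta prod.collapse by blast+
  have "smooth_near A B f p" if p: "p \<in> W" for p
  proof -
    have "p \<in> points A" using W(1) p A by (auto simp: openin_atlas)
    then obtain c where c: "c \<in> A" "p \<in> fst c" by (auto simp: points_def)
    have "f p \<in> points B" using p W(2) by blast
    then obtain d where d: "d \<in> B" "f p \<in> fst d" by (auto simp: points_def)
    let ?S = "fst c \<inter> W \<inter> f -` fst d"
    \<comment> \<open>By injectivity \<open>?S\<close> is the chart preimage of its own image; this
      carries openness from the model space, where \<open>smooth_map\<close> asserts it, to the
      manifold.\<close>
    have "?S = {q \<in> fst c. snd c q \<in> snd c ` ?S}"
      using smooth_atlas_inj[OF A c(1)] by (auto simp: inj_on_def)
    then have S: "openin (atlas_topology A) ?S"
      using openin_chart_vimage[OF A c(1), of "snd c ` ?S"] *[OF c(1) d(1)] by simp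
    show ?thesis
      by (rule smooth_nearI[OF c(1) d(1) S]) (use *[OF c(1) d(1)] p c(2) d(2) in blast)+
  qed
  then show "openin (atlas_topology A) W \<and> (\<forall>p\<in>W. smooth_near A B f p)" using W by blast
next
  assume *: "openin (atlas_topology A) W \<and> (\<forall>p\<in>W. smooth_near A B f p)"
  have "open (snd c ` (fst c \<inter> W \<inter> f -` fst d)) \<and>
        smooth_on (snd c ` (fst c \<inter> W \<inter> f -` fst d)) (local_rep c d f)" (is "open ?S \<and> _")
    if c: "c \<in> A" and d: "d \<in> B" for c d
  proof -
    have T: "\<exists>T. open T \<and> x \<in> T \<and> T \<subseteq> ?S \<and> smooth_on T (local_rep c d f)" if x: "x \<in> ?S" for x
    proof -
      obtain p where p: "p \<in> fst c" "p \<in> W" "f p \<in> fst d" "x = snd c p" using x by blast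
      obtain V where V: "openin (atlas_topology A) V" "p \<in> V" "V \<subseteq> fst c" "f ` V \<subseteq> fst d"
        "smooth_on (snd c ` V) (local_rep c d f)"
        using smooth_near_charts[of A B f p c d] A B c p d * by blast
      show ?thesis
      proof (intro exI conjI)
        show "open (snd c ` (V \<inter> W))"
          using * V by (intro open_chart_image[OF A c]) auto
        show "smooth_on (snd c ` (V \<inter> W)) (local_rep c d f)"
          by (rule smooth_on_subset[OF V(5)]) auto
      qed (use p V in blast)+
    qed
    show ?thesis
    proof
      show "open ?S" by (subst open_subopen) (use T in blast)
      show "smooth_on ?S (local_rep c d f)" by (rule smooth_on_local) (use T in blast)
    qed
  qed
  moreover have "f ` W \<subseteq> points B" using * smooth_near_points(2)[of A B f] by (simp add: image_subsetI)
  ultimately show "smooth_map A B W f"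
    unfolding smooth_map_def case_prod_beta prod.collapse using conjunct1[OF *] by blast
qed

lemma smooth_near_compose:
  assumes A: "smooth_atlas A" and B: "smooth_atlas B" and C: "smooth_atlas C"
    and f: "smooth_near A B f p" and g: "smooth_near B C g (f p)"
  shows "smooth_near A C (\<lambda>x. g (f x)) p"
proof -
  obtain c d W where c: "c \<in> A" and d: "d \<in> B"
    and W: "openin (atlas_topology A) W" "p \<in> W" "W \<subseteq> fst c" "f ` W \<subseteq> fst d"
    and sm: "smooth_on (snd c ` W) (local_rep c d f)"
    using f by (rule smooth_nearE)
  obtain e where e: "e \<in> C" "g (f p) \<in> fst e"
    using smooth_near_points(2)[OF g] by (auto simp: points_def)
  have "f p \<in> fst d" using W by blast
  then obtain V where V: "openin (atlas_topology B) V" "f p \<in> V" "V \<subseteq> fst d" "g ` V \<subseteq> fst e"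
    "smooth_on (snd d ` V) (local_rep d e g)"
    using smooth_near_charts[OF B C g d _ e] by blast
  let ?W = "{q \<in> W. f q \<in> V}"
  have oW: "openin (atlas_topology A) ?W"
    by (rule openin_vimage_local_rep[OF A c B d W(1,3,4) smooth_on_imp_continuous_on[OF sm] V(1)])
  have sub: "?W \<subseteq> fst c" using W by auto
  have o: "open (snd c ` ?W)" by (rule open_chart_image[OF A c oW sub])
  have "smooth_on (snd c ` ?W) (\<lambda>x. local_rep d e g (local_rep c d f x))"
  proof (rule smooth_on_compose[OF o smooth_on_subset[OF sm] V(5)])
    show "local_rep c d f ` snd c ` ?W \<subseteq> snd d ` V"
      by (auto simp: local_rep_eq[OF A c subsetD[OF sub]])
  qed auto
  then have "smooth_on (snd c ` ?W) (local_rep c e (\<lambda>x. g (f x)))"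
  proof (rule smooth_on_cong[OF o, THEN iffD2, rotated])
    fix x assume "x \<in> snd c ` ?W"
    then obtain q where q: "q \<in> fst c" "f q \<in> fst d" "x = snd c q" using sub V(3) by blast
    then show "local_rep c e (\<lambda>x. g (f x)) x = local_rep d e g (local_rep c d f x)"
      by (simp add: local_rep_eq[OF A c] local_rep_eq[OF B d])
  qed
  then show ?thesis
    using smooth_nearI[OF c e(1) oW _ sub, of p "\<lambda>x. g (f x)"] W(2) V(2,4) by auto
qed

lemma openin_smooth_vimage:
  assumes A: "smooth_atlas A" and B: "smooth_atlas B" and W: "openin (atlas_topology A) W"
    and f: "\<And>p. p \<in> W \<Longrightarrow> smooth_near A B f p" and V: "openin (atlas_topology B) V"
  shows "openin (atlas_topology A) {p \<in> W. f p \<in> V}"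
proof (subst openin_subopen, intro ballI)
  fix p assume p: "p \<in> {p \<in> W. f p \<in> V}"
  then have "smooth_near A B f p" using f by blast
  then obtain c d T where c: "c \<in> A" and d: "d \<in> B"
    and T: "openin (atlas_topology A) T" "p \<in> T" "T \<subseteq> fst c" "f ` T \<subseteq> fst d"
    and sm: "smooth_on (snd c ` T) (local_rep c d f)"
    by (rule smooth_nearE)
  have "openin (atlas_topology A) ({q \<in> T. f q \<in> V} \<inter> W)"
    by (intro openin_Int W openin_vimage_local_rep[OF A c B d T(1,3,4) smooth_on_imp_continuous_on[OF sm] V])
  then show "\<exists>T. openin (atlas_topology A) T \<and> p \<in> T \<and> T \<subseteq> {p \<in> W. f p \<in> V}"
    using p T(2) by (intro exI[of _ "{q \<in> T. f q \<in> V} \<inter> W"]) auto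
qed

lemma smooth_near_id:
  assumes A: "smooth_atlas A" and p: "p \<in> points A"
  shows "smooth_near A A id p"
proof -
  obtain c where c: "c \<in> A" "p \<in> fst c" using p by (auto simp: points_def)
  then show ?thesis
    using smooth_atlas_transition(2)[OF A c(1) c(1)]
    by (intro smooth_nearI[OF c(1) c(1) openin_fst_chart[OF A c(1)]]) simp_all
qed

section \<open>Products\<close>

definition prod_chart :: "('a, 'e) chart \<Rightarrow> ('b, 'f) chart \<Rightarrow> ('a \<times> 'b, 'e \<times> 'f) chart" where
  "prod_chart c d = (fst c \<times> fst d, map_prod (snd c) (snd d))"

lemma prod_atlas_eq: "prod_atlas A B = {prod_chart c d |c d. c \<in> A \<and> d \<in> B}"
  unfolding prod_atlas_def prod_chart_def by force

lemma prod_chart_in_prod_atlas: "c \<in> A \<Longrightarrow> d \<in> B \<Longrightarrow> prod_chart c d \<in> prod_atlas A B"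
  unfolding prod_atlas_eq by blast

lemma fst_prod_chart: "fst (prod_chart c d) = fst c \<times> fst d"
  and snd_prod_chart: "snd (prod_chart c d) p = (snd c (fst p), snd d (snd p))"
  by (simp_all add: prod_chart_def map_prod_def split_beta)

lemma snd_prod_chart_image: "snd (prod_chart c d) ` (S \<times> T) = (snd c ` S) \<times> (snd d ` T)"
  by (auto simp: prod_chart_def)

lemma chart_inv_prod_chart:
  assumes "inj_on (snd c) (fst c)" "inj_on (snd d) (fst d)" "p \<in> fst c" "q \<in> fst d"
  shows "chart_inv (prod_chart c d) (snd c p, snd d q) = (p, q)"
proof -
  have "inj_on (map_prod (snd c) (snd d)) (fst c \<times> fst d)" by (rule map_prod_inj_on) fact+
  then have "inv_into (fst c \<times> fst d) (map_prod (snd c) (snd d)) (map_prod (snd c) (snd d) (p, q)) = (p, q)"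
    using assms(3,4) by (intro inv_into_f_f) auto
  then show ?thesis by (simp add: chart_inv_def prod_chart_def)
qed

lemma smooth_atlas_prod:
  assumes A: "smooth_atlas A" and B: "smooth_atlas B"
  shows "smooth_atlas (prod_atlas A B)"
  unfolding smooth_atlas_def
proof (intro conjI ballI)
  fix x assume "x \<in> prod_atlas A B"
  then obtain c d where x: "x = prod_chart c d" and c: "c \<in> A" and d: "d \<in> B" by (auto simp: prod_atlas_eq)
  show "inj_on (snd x) (fst x)"
    unfolding x prod_chart_def fst_conv snd_conv
    by (rule map_prod_inj_on) (rule smooth_atlas_inj[OF A c] smooth_atlas_inj[OF B d])+
  show "open (snd x ` fst x)"
    using A B c d by (simp add: x fst_prod_chart snd_prod_chart_image open_Times smooth_atlas_def)
  fix y assume "y \<in> prod_atlas A B"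
  then obtain c' d' where y: "y = prod_chart c' d'" and c': "c' \<in> A" and d': "d' \<in> B" by (auto simp: prod_atlas_eq)
  have S: "snd x ` (fst x \<inter> fst y) = snd c ` (fst c \<inter> fst c') \<times> snd d ` (fst d \<inter> fst d')"
    unfolding x y fst_prod_chart Times_Int_Times snd_prod_chart_image ..
  show o: "open (snd x ` (fst x \<inter> fst y))"
    unfolding S using A B c d c' d' by (simp add: open_Times smooth_atlas_def)
  have "smooth_on (snd x ` (fst x \<inter> fst y)) (\<lambda>z. (local_rep c c' id (fst z), local_rep d d' id (snd z)))"
  proof (rule smooth_on_Pair[OF o])
    show "smooth_on (snd x ` (fst x \<inter> fst y)) (\<lambda>z. local_rep c c' id (fst z))"
      by (rule smooth_on_compose[OF o smooth_on_fst[OF o smooth_on_id] smooth_atlas_transition(2)[OF A c c']])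
        (auto simp: S)
    show "smooth_on (snd x ` (fst x \<inter> fst y)) (\<lambda>z. local_rep d d' id (snd z))"
      by (rule smooth_on_compose[OF o smooth_on_snd[OF o smooth_on_id] smooth_atlas_transition(2)[OF B d d']])
        (auto simp: S)
  qed
  then show "smooth_on (snd x ` (fst x \<inter> fst y)) (local_rep x y id)"
  proof (rule smooth_on_cong[OF o, THEN iffD2, rotated])
    fix z assume "z \<in> snd x ` (fst x \<inter> fst y)"
    then obtain p q where "p \<in> fst c" "q \<in> fst d" "z = (snd c p, snd d q)" unfolding S by auto
    moreover from this have "local_rep x y id z = (snd c' p, snd d' q)"
      using chart_inv_prod_chart[OF smooth_atlas_inj[OF A c] smooth_atlas_inj[OF B d], of p q]
      by (simp add: local_rep_def x y snd_prod_chart)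
    ultimately show "local_rep x y id z = (local_rep c c' id (fst z), local_rep d d' id (snd z))"
      by (simp add: local_rep_eq[OF A c] local_rep_eq[OF B d])
  qed
qed

lemma points_prod: "points (prod_atlas A B) = points A \<times> points B"
proof -
  have "\<Union> (fst ` prod_atlas A B) = (\<Union>c\<in>A. \<Union>d\<in>B. fst c \<times> fst d)"
    unfolding prod_atlas_eq fst_prod_chart[symmetric] by blast
  then show ?thesis unfolding points_def by (simp only:) blast
qed

lemma smooth_near_Pair:
  assumes A: "smooth_atlas A" and B: "smooth_atlas B" and C: "smooth_atlas C"
    and f: "smooth_near A B f p" and g: "smooth_near A C g p"
  shows "smooth_near A (prod_atlas B C) (\<lambda>x. (f x, g x)) p"
proof -
  obtain c d W where c: "c \<in> A" and d: "d \<in> B"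
    and W: "openin (atlas_topology A) W" "p \<in> W" "W \<subseteq> fst c" "f ` W \<subseteq> fst d"
    and sm: "smooth_on (snd c ` W) (local_rep c d f)"
    using f by (rule smooth_nearE)
  obtain e where e: "e \<in> C" "g p \<in> fst e"
    using smooth_near_points(2)[OF g] by (auto simp: points_def)
  have "p \<in> fst c" using W by blast
  then obtain V where V: "openin (atlas_topology A) V" "p \<in> V" "V \<subseteq> fst c" "g ` V \<subseteq> fst e"
    "smooth_on (snd c ` V) (local_rep c e g)"
    using smooth_near_charts[OF A C g c _ e] by blast
  have o: "openin (atlas_topology A) (W \<inter> V)" using W V by blast
  have sub: "W \<inter> V \<subseteq> fst c" using W by blast
  have "smooth_on (snd c ` (W \<inter> V)) (\<lambda>x. (local_rep c d f x, local_rep c e g x))"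
    by (rule smooth_on_Pair[OF open_chart_image[OF A c o sub] smooth_on_subset[OF sm] smooth_on_subset[OF V(5)]]) auto
  moreover have "local_rep c (prod_chart d e) (\<lambda>x. (f x, g x)) = (\<lambda>x. (local_rep c d f x, local_rep c e g x))"
    by (simp add: local_rep_def fun_eq_iff snd_prod_chart)
  moreover have "prod_chart d e \<in> prod_atlas B C" using d e by (simp add: prod_chart_in_prod_atlas)
  ultimately show ?thesis
    using W V by (intro smooth_nearI[OF c _ o _ sub, of "prod_chart d e"]) (auto simp: fst_prod_chart)
qed

lemma smooth_near_fst_snd:
  assumes A: "smooth_atlas A" and B: "smooth_atlas B" and p: "p \<in> points (prod_atlas A B)"
  shows "smooth_near (prod_atlas A B) A fst p" "smooth_near (prod_atlas A B) B snd p"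
proof -
  have P: "smooth_atlas (prod_atlas A B)" by (rule smooth_atlas_prod[OF A B])
  obtain c d where c: "c \<in> A" "fst p \<in> fst c" and d: "d \<in> B" "snd p \<in> fst d"
    using p by (auto simp: points_prod) (auto simp: points_def)
  let ?x = "prod_chart c d"
  have x: "?x \<in> prod_atlas A B" "p \<in> fst ?x" using c d by (auto simp: prod_chart_in_prod_atlas fst_prod_chart mem_Times_iff)
  have W: "openin (atlas_topology (prod_atlas A B)) (fst ?x)" by (rule openin_fst_chart[OF P x(1)])
  have o: "open (snd ?x ` fst ?x)" by (rule open_chart_image[OF P x(1) W]) simp
  have "smooth_on (snd ?x ` fst ?x) (local_rep ?x c fst)"
  proof (rule smooth_on_cong[OF o, THEN iffD2, rotated, OF smooth_on_fst[OF o smooth_on_id]])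
    show "local_rep ?x c fst z = fst z" if "z \<in> snd ?x ` fst ?x" for z
      using that by (elim imageE) (simp only: local_rep_eq[OF P x(1)], simp add: snd_prod_chart)
  qed
  then show "smooth_near (prod_atlas A B) A fst p"
    by (intro smooth_nearI[OF x(1) c(1) W x(2)]) (auto simp: fst_prod_chart)
  have "smooth_on (snd ?x ` fst ?x) (local_rep ?x d snd)"
  proof (rule smooth_on_cong[OF o, THEN iffD2, rotated, OF smooth_on_snd[OF o smooth_on_id]])
    show "local_rep ?x d snd z = snd z" if "z \<in> snd ?x ` fst ?x" for z
      using that by (elim imageE) (simp only: local_rep_eq[OF P x(1)], simp add: snd_prod_chart)
  qed
  then show "smooth_near (prod_atlas A B) B snd p"
    by (intro smooth_nearI[OF x(1) d(1) W x(2)]) (auto simp: fst_prod_chart)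
qed

section \<open>Tangent maps\<close>

text \<open>The common form of \<open>to_coords\<close>, \<open>from_coords\<close> and
  \<open>tangent_map_at\<close>, so that a single chain rule in arbitrary charts serves all
  three.\<close>

definition chart_deriv ::
  "('a, 'e::euclidean_space) chart \<Rightarrow> ('b, 'f::euclidean_space) chart \<Rightarrow> ('a \<Rightarrow> 'b) \<Rightarrow> 'a \<Rightarrow> 'e \<Rightarrow> 'f" where
  "chart_deriv c d f p = frechet_derivative (local_rep c d f) (at (snd c p))"

lemma has_derivative_local_rep:
  assumes "smooth_atlas A" "smooth_atlas B" "smooth_near A B f p"
    and "c \<in> A" "p \<in> fst c" "d \<in> B" "f p \<in> fst d"
  shows "(local_rep c d f has_derivative chart_deriv c d f p) (at (snd c p))"
proof -
  obtain W where "p \<in> W" "smooth_on (snd c ` W) (local_rep c d f)"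
    using smooth_near_charts[OF assms] by metis
  then show ?thesis unfolding chart_deriv_def by (intro smooth_on_has_derivative) auto
qed

lemma linear_chart_deriv:
  assumes "smooth_atlas A" "smooth_atlas B" "smooth_near A B f p"
    and "c \<in> A" "p \<in> fst c" "d \<in> B" "f p \<in> fst d"
  shows "linear (chart_deriv c d f p)"
  using has_derivative_local_rep[OF assms] has_derivative_bounded_linear bounded_linear.linear by metis

text \<open>The local representations compose only where \<open>f\<close> stays inside the domain of
  \<open>d\<close>; the set \<open>W\<close> supplies such a neighbourhood, and the derivative
  depends on nothing further away.\<close>

lemma chart_deriv_compose:
  assumes A: "smooth_atlas A" and B: "smooth_atlas B" and C: "smooth_atlas C"
    and f: "smooth_near A B f p" and g: "smooth_near B C g (f p)"
    and c: "c \<in> A" "p \<in> fst c" and d: "d \<in> B" "f p \<in> fst d" and e: "e \<in> C" "g (f p) \<in> fst e"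
  shows "chart_deriv c e (\<lambda>x. g (f x)) p v = chart_deriv d e g (f p) (chart_deriv c d f p v)"
proof -
  obtain W where W: "openin (atlas_topology A) W" "p \<in> W" "W \<subseteq> fst c" "f ` W \<subseteq> fst d"
    using smooth_near_charts[OF A B f c d] by metis
  have "(local_rep d e g has_derivative chart_deriv d e g (f p)) (at (local_rep c d f (snd c p)))"
    using has_derivative_local_rep[OF B C g d e] by (simp add: local_rep_eq[OF A c])
  from has_derivative_compose[OF has_derivative_local_rep[OF A B f c d] this]
  have "((\<lambda>x. local_rep d e g (local_rep c d f x)) has_derivative
      (\<lambda>v. chart_deriv d e g (f p) (chart_deriv c d f p v))) (at (snd c p))" .
  moreover have "frechet_derivative (local_rep c e (\<lambda>x. g (f x))) (at (snd c p)) =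
      frechet_derivative (\<lambda>x. local_rep d e g (local_rep c d f x)) (at (snd c p))"
  proof (rule frechet_derivative_cong_open[OF open_chart_image[OF A c(1) W(1,3)]])
    show "snd c p \<in> snd c ` W" using W(2) by simp
    fix y assume "y \<in> snd c ` W"
    then obtain q where q: "q \<in> fst c" "f q \<in> fst d" "y = snd c q" using W(3,4) by blast
    then show "local_rep c e (\<lambda>x. g (f x)) y = local_rep d e g (local_rep c d f y)"
      by (simp add: local_rep_eq[OF A c(1)] local_rep_eq[OF B d(1)])
  qed
  ultimately show ?thesis
    unfolding chart_deriv_def[of c e] using frechet_derivative_at by metis
qed

lemma chart_deriv_id:
  assumes A: "smooth_atlas A" and c: "c \<in> A" "p \<in> fst c"
  shows "chart_deriv c c id p v = v"
proof -
  have "(local_rep c c id has_derivative (\<lambda>v. v)) (at (snd c p))"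
    by (rule has_derivative_transform_within_open[OF has_derivative_ident
          open_chart_image[OF A c(1) openin_fst_chart[OF A c(1)] subset_refl]])
      (use c in \<open>auto simp: local_rep_eq[OF A c(1)]\<close>)
  then show ?thesis unfolding chart_deriv_def using frechet_derivative_at by metis
qed

lemma chart_at_in:
  assumes "p \<in> points A" shows "chart_at A p \<in> A" "p \<in> fst (chart_at A p)"
proof -
  have "\<exists>c. c \<in> A \<and> p \<in> fst c" using assms unfolding points_def by blast
  then show "chart_at A p \<in> A" "p \<in> fst (chart_at A p)"
    unfolding chart_at_def by (rule someI2_ex, blast)+
qed

lemma pointsI: "c \<in> A \<Longrightarrow> p \<in> fst c \<Longrightarrow> p \<in> points A"
  by (auto simp: points_def)

section \<open>Coordinates of tangent vectors\<close>

lemma to_coords_chart_deriv: "to_coords A c p = chart_deriv (chart_at A p) c id p"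
  and from_coords_chart_deriv: "from_coords A c p = chart_deriv c (chart_at A p) id p"
  and tangent_map_at_chart_deriv: "tangent_map_at A B f p = chart_deriv (chart_at A p) (chart_at B (f p)) f p"
  by (simp_all add: to_coords_def from_coords_def tangent_map_at_def chart_deriv_def)

text \<open>The cocycle rule for derivatives of transition maps, namely the chain rule for
  \<open>id\<close> after \<open>id\<close>.\<close>

lemma chart_deriv_id_compose:
  assumes A: "smooth_atlas A" and "c \<in> A" "d \<in> A" "e \<in> A" "p \<in> fst c" "p \<in> fst d" "p \<in> fst e"
  shows "chart_deriv d e id p (chart_deriv c d id p v) = chart_deriv c e id p v"
proof -
  note i = smooth_near_id[OF A pointsI[OF assms(2,5)]]
  show ?thesis
    using chart_deriv_compose[OF A A A i _ assms(2,5,3), of id e v] assms i by (simp add: id_def)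
qed

lemma to_coords_transition:
  assumes A: "smooth_atlas A" and c: "c \<in> A" "p \<in> fst c" and d: "d \<in> A" "p \<in> fst d"
  shows "to_coords A d p v = chart_deriv c d id p (to_coords A c p v)"
  unfolding to_coords_chart_deriv
  using chart_deriv_id_compose[OF A chart_at_in(1) c(1) d(1) chart_at_in(2) c(2) d(2)] pointsI[OF c] by simp

lemma to_from_coords:
  assumes A: "smooth_atlas A" and c: "c \<in> A" "p \<in> fst c"
  shows "to_coords A c p (from_coords A c p v) = v" "from_coords A c p (to_coords A c p v) = v"
  unfolding to_coords_chart_deriv from_coords_chart_deriv
  using chart_deriv_id_compose[OF A c(1) chart_at_in(1) c(1) c(2) chart_at_in(2) c(2)]
    chart_deriv_id_compose[OF A chart_at_in(1) c(1) chart_at_in(1) chart_at_in(2) c(2) chart_at_in(2)]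
    chart_deriv_id[OF A c] chart_deriv_id[OF A chart_at_in] pointsI[OF c] by simp_all

lemma linear_to_coords:
  assumes A: "smooth_atlas A" and c: "c \<in> A" "p \<in> fst c"
  shows "linear (to_coords A c p)" "linear (from_coords A c p)"
  unfolding to_coords_chart_deriv from_coords_chart_deriv
  by (rule linear_chart_deriv[OF A A smooth_near_id[OF A]];
      use c chart_at_in[OF pointsI[OF c]] pointsI[OF c] in simp)+

section \<open>The tangent bundle\<close>

definition tangent_chart :: "('a, 'e::euclidean_space) chart set \<Rightarrow> ('a, 'e) chart \<Rightarrow> ('a \<times> 'e, 'e \<times> 'e) chart" where
  "tangent_chart A c = (fst c \<times> UNIV, \<lambda>(p, v). (snd c p, to_coords A c p v))"

lemma tangent_atlas_eq: "tangent_atlas A = tangent_chart A ` A"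
  unfolding tangent_atlas_def tangent_chart_def by force

lemma fst_tangent_chart: "fst (tangent_chart A c) = fst c \<times> UNIV"
  and snd_tangent_chart: "snd (tangent_chart A c) w = (snd c (fst w), to_coords A c (fst w) (snd w))"
  by (simp_all add: tangent_chart_def case_prod_beta)

lemma points_tangent: "points (tangent_atlas A) = points A \<times> UNIV"
  unfolding points_def tangent_atlas_eq by (auto simp: fst_tangent_chart)

lemma snd_tangent_chart_image:
  assumes A: "smooth_atlas A" and c: "c \<in> A" "S \<subseteq> fst c"
  shows "snd (tangent_chart A c) ` (S \<times> UNIV) = snd c ` S \<times> UNIV"
proof
  show "snd (tangent_chart A c) ` (S \<times> UNIV) \<subseteq> snd c ` S \<times> UNIV" by (auto simp: snd_tangent_chart)
  show "snd c ` S \<times> UNIV \<subseteq> snd (tangent_chart A c) ` (S \<times> UNIV)"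
  proof clarify
    fix p v assume p: "p \<in> S"
    have "(snd c p, v) = snd (tangent_chart A c) (p, from_coords A c p v)"
      using to_from_coords(1)[OF A c(1), of p] p c(2) by (auto simp: snd_tangent_chart)
    then show "(snd c p, v) \<in> snd (tangent_chart A c) ` (S \<times> UNIV)" using p by blast
  qed
qed

lemma inj_on_tangent_chart:
  assumes A: "smooth_atlas A" and c: "c \<in> A"
  shows "inj_on (snd (tangent_chart A c)) (fst (tangent_chart A c))"
proof (rule inj_onI)
  fix w w' assume w: "w \<in> fst (tangent_chart A c)" "w' \<in> fst (tangent_chart A c)"
    and eq: "snd (tangent_chart A c) w = snd (tangent_chart A c) w'"
  then have "fst w = fst w'"
    using inj_onD[OF smooth_atlas_inj[OF A c]] by (auto simp: fst_tangent_chart snd_tangent_chart)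
  moreover have "snd w = snd w'"
    using eq to_from_coords(2)[OF A c, of "fst w" "snd w"] to_from_coords(2)[OF A c, of "fst w" "snd w'"] w
      \<open>fst w = fst w'\<close> by (auto simp: fst_tangent_chart snd_tangent_chart)
  ultimately show "w = w'" by (rule prod_eqI)
qed

text \<open>The common shape of a transition map between tangent charts and of a tangent map in
  charts.\<close>

lemma smooth_on_tangent:
  assumes S: "open S" and f: "smooth_on S f"
  shows "smooth_on (S \<times> UNIV) (\<lambda>z. (f (fst z), frechet_derivative f (at (fst z)) (snd z)))"
proof -
  have o: "open (S \<times> UNIV)" using S by (simp add: open_Times)
  have fst: "smooth_on (S \<times> UNIV) fst" and snd: "smooth_on (S \<times> UNIV) snd"
    using smooth_on_fst[OF o smooth_on_id] smooth_on_snd[OF o smooth_on_id] by simp_all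
  show ?thesis
  proof (rule smooth_on_Pair[OF o smooth_on_compose[OF o fst f]])
    show "smooth_on (S \<times> UNIV) (\<lambda>z. frechet_derivative f (at (fst z)) (snd z))"
    proof (rule smooth_on_linear_family[OF o _ _ snd])
      show "smooth_on (S \<times> UNIV) (\<lambda>z. frechet_derivative f (at (fst z)) b)" for b
        by (rule smooth_on_compose[OF o fst smooth_on_frechet_derivative[OF f]]) auto
    qed (use smooth_on_linear_derivative[OF f] in auto)
  qed auto
qed

text \<open>The chart chosen at each point may jump from point to point, but it cancels in the
  change of coordinates by \<open>to_coords_transition\<close>. What remains is the derivative of a
  transition map of the base.\<close>

lemma smooth_atlas_tangent:
  assumes A: "smooth_atlas A"
  shows "smooth_atlas (tangent_atlas A)"
  unfolding smooth_atlas_def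
proof (intro conjI ballI)
  fix x assume "x \<in> tangent_atlas A"
  then obtain c where x: "x = tangent_chart A c" and c: "c \<in> A" by (auto simp: tangent_atlas_eq)
  show inj: "inj_on (snd x) (fst x)" unfolding x by (rule inj_on_tangent_chart[OF A c])
  show "open (snd x ` fst x)"
    using A c by (simp add: x fst_tangent_chart snd_tangent_chart_image open_Times smooth_atlas_def)
  fix y assume "y \<in> tangent_atlas A"
  then obtain d where y: "y = tangent_chart A d" and d: "d \<in> A" by (auto simp: tangent_atlas_eq)
  have I: "fst x \<inter> fst y = (fst c \<inter> fst d) \<times> UNIV" by (auto simp: x y fst_tangent_chart)
  have S: "snd x ` (fst x \<inter> fst y) = snd c ` (fst c \<inter> fst d) \<times> UNIV"
    unfolding I unfolding x by (rule snd_tangent_chart_image[OF A c]) simp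
  show o: "open (snd x ` (fst x \<inter> fst y))"
    unfolding S using smooth_atlas_transition(1)[OF A c d] by (simp add: open_Times)
  have "smooth_on (snd x ` (fst x \<inter> fst y))
     (\<lambda>z. (local_rep c d id (fst z), frechet_derivative (local_rep c d id) (at (fst z)) (snd z)))"
    unfolding S by (rule smooth_on_tangent[OF smooth_atlas_transition[OF A c d]])
  then show "smooth_on (snd x ` (fst x \<inter> fst y)) (local_rep x y id)"
  proof (rule smooth_on_cong[OF o, THEN iffD2, rotated])
    fix z assume "z \<in> snd x ` (fst x \<inter> fst y)"
    then obtain w where w: "w \<in> fst x" "w \<in> fst y" "z = snd x w" by blast
    then have p: "fst w \<in> fst c" "fst w \<in> fst d" by (auto simp: x y fst_tangent_chart)
    have "local_rep x y id z = snd y w"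
      unfolding w local_rep_def chart_inv_def o_def by (simp add: inv_into_f_f[OF inj w(1)])
    then show "local_rep x y id z =
        (local_rep c d id (fst z), frechet_derivative (local_rep c d id) (at (fst z)) (snd z))"
      using to_coords_transition[OF A c p(1) d p(2), of "snd w"]
      by (simp add: w x y snd_tangent_chart local_rep_eq[OF A c p(1)] chart_deriv_def)
  qed
qed

lemma openin_tangent:
  assumes A: "smooth_atlas A" and W: "openin (atlas_topology A) W"
  shows "openin (atlas_topology (tangent_atlas A)) (W \<times> UNIV)"
  unfolding openin_atlas[OF smooth_atlas_tangent[OF A]] points_tangent
proof (intro conjI ballI)
  show "W \<times> UNIV \<subseteq> points A \<times> UNIV" using W by (auto simp: openin_atlas[OF A])
  fix x assume "x \<in> tangent_atlas A"
  then obtain c where x: "x = tangent_chart A c" and c: "c \<in> A" by (auto simp: tangent_atlas_eq)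
  have I: "W \<times> UNIV \<inter> fst x = (W \<inter> fst c) \<times> UNIV" by (auto simp: x fst_tangent_chart)
  have "snd x ` (W \<times> UNIV \<inter> fst x) = snd c ` (W \<inter> fst c) \<times> UNIV"
    unfolding I unfolding x by (rule snd_tangent_chart_image[OF A c]) simp
  then show "open (snd x ` (W \<times> UNIV \<inter> fst x))"
    using W c by (simp add: openin_atlas[OF A] open_Times)
qed

section \<open>Functoriality and smoothness of tangent maps\<close>

lemma tangent_map_compose:
  assumes A: "smooth_atlas A" and B: "smooth_atlas B" and C: "smooth_atlas C"
    and f: "smooth_near A B f p" and g: "smooth_near B C g (f p)"
  shows "tangent_map_at A C (\<lambda>x. g (f x)) p v = tangent_map_at B C g (f p) (tangent_map_at A B f p v)"
  unfolding tangent_map_at_chart_deriv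
  by (rule chart_deriv_compose[OF A B C f g]; intro chart_at_in smooth_near_points[OF f] smooth_near_points[OF g])

lemma linear_tangent_map_at:
  assumes "smooth_atlas A" "smooth_atlas B" "smooth_near A B f p"
  shows "linear (tangent_map_at A B f p)"
  unfolding tangent_map_at_chart_deriv
  by (rule linear_chart_deriv[OF assms]; intro chart_at_in smooth_near_points[OF assms(3)])

lemma tangent_map_at_id:
  assumes A: "smooth_atlas A" and p: "p \<in> points A"
  shows "tangent_map_at A A id p v = v"
  unfolding tangent_map_at_chart_deriv
  using chart_deriv_id[OF A chart_at_in[OF p]] by simp

lemma tangent_map_at_cong:
  assumes A: "smooth_atlas A" and W: "openin (atlas_topology A) W" "p \<in> W" "\<And>q. q \<in> W \<Longrightarrow> f q = g q"
  shows "tangent_map_at A B f p = tangent_map_at A B g p"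
proof -
  have p: "p \<in> points A" using W(1,2) by (auto simp: openin_atlas[OF A])
  let ?c = "chart_at A p"
  note c = chart_at_in[OF p]
  have o: "openin (atlas_topology A) (W \<inter> fst ?c)" using W(1) openin_fst_chart[OF A c(1)] by blast
  show ?thesis
    unfolding tangent_map_at_def W(3)[OF W(2)]
  proof (rule frechet_derivative_cong_open[OF open_chart_image[OF A c(1) o]])
    show "snd ?c p \<in> snd ?c ` (W \<inter> fst ?c)" using W(2) c by auto
    show "local_rep ?c (chart_at B (g p)) f y = local_rep ?c (chart_at B (g p)) g y"
      if "y \<in> snd ?c ` (W \<inter> fst ?c)" for y
      using that W(3) by (auto simp: local_rep_eq[OF A c(1)])
  qed simp
qed

lemma smooth_near_tangent_map:
  assumes A: "smooth_atlas A" and B: "smooth_atlas B" and f: "smooth_near A B f (fst w)"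
  shows "smooth_near (tangent_atlas A) (tangent_atlas B) (tangent_map A B f) w"
proof -
  note TA = smooth_atlas_tangent[OF A]
  obtain c d W where c: "c \<in> A" and d: "d \<in> B"
    and W: "openin (atlas_topology A) W" "fst w \<in> W" "W \<subseteq> fst c" "f ` W \<subseteq> fst d"
    and sm: "smooth_on (snd c ` W) (local_rep c d f)"
    using f by (rule smooth_nearE)
  let ?x = "tangent_chart A c" and ?y = "tangent_chart B d"
  have x: "?x \<in> tangent_atlas A" and y: "?y \<in> tangent_atlas B" using c d by (simp_all add: tangent_atlas_eq)
  have sub: "W \<times> UNIV \<subseteq> fst ?x" using W by (auto simp: fst_tangent_chart)
  have S: "snd ?x ` (W \<times> UNIV) = snd c ` W \<times> UNIV" by (rule snd_tangent_chart_image[OF A c W(3)])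
  have oW: "open (snd c ` W)" by (rule open_chart_image[OF A c W(1,3)])
  have o: "open (snd ?x ` (W \<times> UNIV))" unfolding S using oW by (simp add: open_Times)
  have "smooth_on (snd ?x ` (W \<times> UNIV))
     (\<lambda>z. (local_rep c d f (fst z), frechet_derivative (local_rep c d f) (at (fst z)) (snd z)))"
    unfolding S by (rule smooth_on_tangent[OF oW sm])
  then have "smooth_on (snd ?x ` (W \<times> UNIV)) (local_rep ?x ?y (tangent_map A B f))"
  proof (rule smooth_on_cong[OF o, THEN iffD2, rotated])
    fix z assume "z \<in> snd ?x ` (W \<times> UNIV)"
    then obtain q v where q: "q \<in> W" "z = snd ?x (q, v)" by blast
    have qc: "q \<in> fst c" and qd: "f q \<in> fst d" using q W by blast+
    have fq: "smooth_near A B f q" by (rule smooth_nearI[OF c d W(1) q(1) W(3,4) sm])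
    note cq = chart_at_in[OF smooth_near_points(1)[OF fq]] and dq = chart_at_in[OF smooth_near_points(2)[OF fq]]
    note iq = smooth_near_id[OF A smooth_near_points(1)[OF fq]] and jq = smooth_near_id[OF B smooth_near_points(2)[OF fq]]
    \<comment> \<open>The charts chosen at \<open>q\<close> and \<open>f q\<close> vary with
      \<open>q\<close>; the chain rule with identity maps exchanges them for the fixed charts
      \<open>c\<close> and \<open>d\<close>.\<close>
    have "to_coords B d (f q) (tangent_map_at A B f q v) = chart_deriv (chart_at A q) d f q v"
      unfolding to_coords_chart_deriv tangent_map_at_chart_deriv
      using chart_deriv_compose[OF A B B fq _ cq dq d, of id v] jq qd by simp
    also have "\<dots> = chart_deriv c d f q (to_coords A c q v)"
      unfolding to_coords_chart_deriv tangent_map_at_chart_deriv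
      using chart_deriv_compose[OF A A B iq _ cq c _ d, of f v] fq qc qd by simp
    finally have "snd ?y (tangent_map A B f (q, v)) = (snd d (f q), chart_deriv c d f q (to_coords A c q v))"
      by (simp add: tangent_map_def snd_tangent_chart)
    moreover have "local_rep ?x ?y (tangent_map A B f) z = snd ?y (tangent_map A B f (q, v))"
      unfolding q(2) by (rule local_rep_eq[OF TA x]) (simp add: fst_tangent_chart qc)
    ultimately show "local_rep ?x ?y (tangent_map A B f) z =
        (local_rep c d f (fst z), frechet_derivative (local_rep c d f) (at (fst z)) (snd z))"
      by (simp add: q(2) snd_tangent_chart local_rep_eq[OF A c qc] chart_deriv_def)
  qed
  moreover have "tangent_map A B f ` (W \<times> UNIV) \<subseteq> fst ?y"
    using W(4) by (auto simp: tangent_map_def fst_tangent_chart)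
  moreover have "w \<in> W \<times> UNIV" using W(2) by (cases w) simp
  ultimately show ?thesis
    using smooth_nearI[OF x y openin_tangent[OF A W(1)] _ sub] by blast
qed

section \<open>Vector spaces as manifolds\<close>

lemma smooth_atlas_euclidean: "smooth_atlas (euclidean_atlas :: ('e::euclidean_space, 'e) chart set)"
proof -
  have "chart_inv (UNIV, id) = (id :: 'e \<Rightarrow> 'e)" by (simp add: chart_inv_def fun_eq_iff)
  then have "local_rep (UNIV, id) (UNIV, id) id = (\<lambda>x :: 'e. x)" by (simp add: local_rep_def fun_eq_iff)
  then show ?thesis by (simp add: smooth_atlas_def euclidean_atlas_def smooth_on_id)
qed

lemma chart_at_euclidean: "chart_at euclidean_atlas p = (UNIV, id)"
  unfolding chart_at_def euclidean_atlas_def by (rule some_equality) auto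

lemma local_rep_euclidean: "local_rep (UNIV, id) d f = (\<lambda>x. snd d (f x))"
  by (simp add: local_rep_def chart_inv_def fun_eq_iff)

lemma smooth_near_linear:
  assumes "linear L" shows "smooth_near euclidean_atlas euclidean_atlas L v"
proof (rule smooth_nearI[of "(UNIV, id)" _ "(UNIV, id)" _ UNIV])
  show "openin (atlas_topology euclidean_atlas) (UNIV :: 'a set)"
    using openin_fst_chart[OF smooth_atlas_euclidean, of "(UNIV, id)"] by (simp add: euclidean_atlas_def)
qed (simp_all add: euclidean_atlas_def local_rep_euclidean smooth_on_linear[OF assms])

lemma tangent_map_at_linear:
  assumes "linear L" shows "tangent_map_at euclidean_atlas euclidean_atlas L v = L"
  unfolding tangent_map_at_def chart_at_euclidean local_rep_euclidean
  using frechet_derivative_at[OF linear_imp_has_derivative[OF assms]] by simp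

text \<open>Composition with this inclusion restricts a map on the tangent bundle to one fibre, the
  form in which \<open>discretization_map\<close> states its derivative condition.\<close>

lemma smooth_near_fibre:
  assumes A: "smooth_atlas A" and p: "p \<in> points A"
  shows "smooth_near euclidean_atlas (tangent_atlas A) (\<lambda>u. (p, u)) v"
proof -
  obtain c where c: "c \<in> A" "p \<in> fst c" using p by (auto simp: points_def)
  have o: "openin (atlas_topology euclidean_atlas) (UNIV :: 'b set)"
    using openin_fst_chart[OF smooth_atlas_euclidean, of "(UNIV, id)"] by (simp add: euclidean_atlas_def)
  have "smooth_on UNIV (\<lambda>u. (snd c p, to_coords A c p u))"
    by (rule smooth_on_Pair[OF open_UNIV smooth_on_const smooth_on_linear[OF linear_to_coords(1)[OF A c]]])
  then show ?thesis
    by (intro smooth_nearI[of "(UNIV, id)" _ "tangent_chart A c", OF _ _ o])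
      (use c in \<open>simp_all add: tangent_atlas_eq euclidean_atlas_def local_rep_euclidean snd_tangent_chart image_subset_iff fst_tangent_chart\<close>)
qed

section \<open>Distributions\<close>

text \<open>A nonzero kernel vector \<open>x\<close> can be subtracted freely, so the hyperplane
  orthogonal to \<open>x\<close> would already have the full range as image, and its dimension is
  too small.\<close>

lemma linear_full_rank_imp_inj:
  fixes L :: "'f::euclidean_space \<Rightarrow> 'e::euclidean_space"
  assumes L: "linear L" and d: "dim (range L) = DIM('f)"
  shows "inj L"
proof -
  have "x = 0" if x: "L x = 0" for x
  proof (rule ccontr)
    assume "x \<noteq> 0"
    have "range L \<subseteq> L ` {y. x \<bullet> y = 0}"
    proof clarify
      fix y
      let ?y = "y - ((x \<bullet> y) / (x \<bullet> x)) *\<^sub>R x"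
      have "x \<bullet> ?y = 0" using \<open>x \<noteq> 0\<close> by (simp add: inner_diff_right)
      moreover have "L y = L ?y" using x by (simp add: linear_diff[OF L] linear_scale[OF L])
      ultimately show "L y \<in> L ` {y. x \<bullet> y = 0}" by blast
    qed
    then have "dim (range L) \<le> dim (L ` {y. x \<bullet> y = 0})" by (rule dim_subset)
    also have "\<dots> \<le> dim {y. x \<bullet> y = 0}" by (rule dim_image_le[OF L])
    also have "\<dots> = DIM('f) - 1" by (rule dim_hyperplane[OF \<open>x \<noteq> 0\<close>])
    also have "\<dots> < DIM('f)" by simp
    finally show False using d by simp
  qed
  then show ?thesis using linear_injective_0[OF L] by blast
qed

text \<open>In the charts \<open>c\<close> and \<open>tangent_chart A c\<close> the base component
  of the section is the identity, so only the coordinates of the field carry a condition.\<close>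

lemma smooth_vector_field_iff:
  assumes A: "smooth_atlas A"
  shows "smooth_vector_field A W X \<longleftrightarrow> openin (atlas_topology A) W \<and>
    (\<forall>c\<in>A. smooth_on (snd c ` (W \<inter> fst c)) (local_field A c X))"
proof -
  note TA = smooth_atlas_tangent[OF A]
  have rep: "local_rep c (tangent_chart A c) (\<lambda>p. (p, X p)) x = (x, local_field A c X x)"
    if c: "c \<in> A" and x: "x \<in> snd c ` fst c" for c x
    using x by (auto simp: local_rep_eq[OF A c] snd_tangent_chart local_field_def chart_inv_eq[OF A c])
  show ?thesis
  proof
    assume X: "smooth_vector_field A W X"
    then have W: "openin (atlas_topology A) W"
      and *: "\<And>p. p \<in> W \<Longrightarrow> smooth_near A (tangent_atlas A) (\<lambda>p. (p, X p)) p"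
      unfolding smooth_vector_field_def smooth_map_iff[OF A TA] by blast+
    have "smooth_on (snd c ` (W \<inter> fst c)) (local_field A c X)" if c: "c \<in> A" for c
    proof (rule smooth_on_local)
      fix x assume "x \<in> snd c ` (W \<inter> fst c)"
      then obtain p where p: "p \<in> W" "p \<in> fst c" "x = snd c p" by blast
      have t: "tangent_chart A c \<in> tangent_atlas A" "(p, X p) \<in> fst (tangent_chart A c)"
        using c p by (simp_all add: tangent_atlas_eq fst_tangent_chart)
      obtain V where V: "openin (atlas_topology A) V" "p \<in> V" "V \<subseteq> fst c"
        "smooth_on (snd c ` V) (local_rep c (tangent_chart A c) (\<lambda>p. (p, X p)))"
        using smooth_near_charts[OF A TA *[OF p(1)] c p(2) t] by metis
      have o: "open (snd c ` V)" by (rule open_chart_image[OF A c V(1,3)])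
      have "smooth_on (snd c ` V) (\<lambda>x. snd (local_rep c (tangent_chart A c) (\<lambda>p. (p, X p)) x))"
        by (rule smooth_on_snd[OF o V(4)])
      then have "smooth_on (snd c ` V) (local_field A c X)"
        by (rule smooth_on_cong[OF o, THEN iffD2, rotated]) (use rep[OF c] V(3) in auto)
      then show "\<exists>T. open T \<and> x \<in> T \<and> smooth_on T (local_field A c X)"
        using o V(2) p(3) by blast
    qed
    then show "openin (atlas_topology A) W \<and> (\<forall>c\<in>A. smooth_on (snd c ` (W \<inter> fst c)) (local_field A c X))"
      using W by blast
  next
    assume *: "openin (atlas_topology A) W \<and> (\<forall>c\<in>A. smooth_on (snd c ` (W \<inter> fst c)) (local_field A c X))"
    then have W: "openin (atlas_topology A) W" by blast
    have "smooth_near A (tangent_atlas A) (\<lambda>p. (p, X p)) p" if p: "p \<in> W" for p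
    proof -
      have "p \<in> points A" using W p by (auto simp: openin_atlas[OF A])
      then obtain c where c: "c \<in> A" "p \<in> fst c" by (auto simp: points_def)
      have oW: "openin (atlas_topology A) (W \<inter> fst c)" using W openin_fst_chart[OF A c(1)] by blast
      have o: "open (snd c ` (W \<inter> fst c))" by (rule open_chart_image[OF A c(1) oW]) simp
      have "smooth_on (snd c ` (W \<inter> fst c)) (\<lambda>x. (x, local_field A c X x))"
        by (rule smooth_on_Pair[OF o smooth_on_id]) (use * c in blast)
      then have "smooth_on (snd c ` (W \<inter> fst c)) (local_rep c (tangent_chart A c) (\<lambda>p. (p, X p)))"
        by (rule smooth_on_cong[OF o, THEN iffD2, rotated]) (rule rep[OF c(1)], blast)
      then show ?thesis
        by (rule smooth_nearI[OF c(1) _ oW, rotated 4])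
          (use c p in \<open>auto simp: tangent_atlas_eq fst_tangent_chart\<close>)
    qed
    then show "smooth_vector_field A W X"
      unfolding smooth_vector_field_def smooth_map_iff[OF A TA] using W by blast
  qed
qed

definition distribution_chart ::
  "('a \<times> 'e) set \<Rightarrow> ('a, 'e) chart \<Rightarrow> 'a set \<Rightarrow> ('a \<Rightarrow> 'f \<Rightarrow> 'e) \<Rightarrow> ('a \<times> 'e, 'e \<times> 'f) chart" where
  "distribution_chart D c W F = ({w \<in> D. fst w \<in> fst c \<inter> W}, \<lambda>(p, v). (snd c p, inv (F p) v))"

lemma distribution_atlas_eq:
  "distribution_atlas Q D = {distribution_chart D c W F |c W F. c \<in> Q \<and> local_trivialization Q D W F}"
  unfolding distribution_atlas_def distribution_chart_def by force

lemma fst_distribution_chart: "fst (distribution_chart D c W F) = {w \<in> D. fst w \<in> fst c \<inter> W}"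
  and snd_distribution_chart: "snd (distribution_chart D c W F) w = (snd c (fst w), inv (F (fst w)) (snd w))"
  by (simp_all add: distribution_chart_def case_prod_beta)

text \<open>The type of \<open>DD\<close> pins down the model fibre \<open>'f\<close>; taking
  \<open>DIM('f)\<close> as the rank makes \<open>'f\<close> fit the fibres of
  \<open>D\<close>.\<close>

locale riemannian_distribution =
  fixes Q :: "('a, 'e::euclidean_space) chart set"
    and G :: "'a \<Rightarrow> 'e \<Rightarrow> 'e \<Rightarrow> real"
    and D :: "('a \<times> 'e) set"
    and DD :: "('a \<times> 'e, 'e \<times> 'f::euclidean_space) chart set"
  assumes Q: "smooth_atlas Q"
    and G: "riemannian_metric Q G"
    and D: "regular_distribution Q DIM('f) D"
    and DD: "DD = distribution_atlas Q D"
begin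

abbreviation TQ :: "('a \<times> 'e, 'e \<times> 'e) chart set" where "TQ \<equiv> tangent_atlas Q"

abbreviation P :: "'a \<times> 'e \<Rightarrow> 'a \<times> 'e" where "P \<equiv> orthogonal_projection G D"

section \<open>Frames, Gram matrices and the orthogonal projection\<close>

lemma bilinear_metric: "p \<in> points Q \<Longrightarrow> bilinear (G p)"
  and metric_pos: "p \<in> points Q \<Longrightarrow> v \<noteq> 0 \<Longrightarrow> 0 < G p v v"
  using G unfolding riemannian_metric_def by blast+

lemma linear_metric:
  assumes "p \<in> points Q" shows "linear (G p v)" "linear (\<lambda>v. G p v w)"
  using bilinear_metric[OF assms] by (simp_all add: bilinear_def)

lemma trivialization:
  assumes "local_trivialization Q D W (F :: 'a \<Rightarrow> 'f \<Rightarrow> 'e)" "p \<in> W"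
  shows "linear (F p)" "inj (F p)" "range (F p) = fibre D p"
  using assms by (simp_all add: local_trivialization_def)

lemma openin_trivialization: "local_trivialization Q D W (F :: 'a \<Rightarrow> 'f \<Rightarrow> 'e) \<Longrightarrow> openin (atlas_topology Q) W"
  by (simp add: local_trivialization_def)

lemma trivialization_subset: "local_trivialization Q D W (F :: 'a \<Rightarrow> 'f \<Rightarrow> 'e) \<Longrightarrow> W \<subseteq> points Q"
  using openin_trivialization openin_atlas[OF Q] by blast

lemma trivialization_inv:
  assumes "local_trivialization Q D W (F :: 'a \<Rightarrow> 'f \<Rightarrow> 'e)" "p \<in> W"
  shows "v \<in> fibre D p \<Longrightarrow> F p (inv (F p) v) = v" "inv (F p) (F p e) = e"
  using trivialization[OF assms] by (auto simp: f_inv_into_f)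

lemma D_subset: "w \<in> D \<Longrightarrow> fst w \<in> points Q"
  using D unfolding regular_distribution_def points_tangent by auto

text \<open>The spanning fields \<open>X i\<close> are reindexed by the basis of \<open>'f\<close>
  through a bijection \<open>h\<close>, and \<open>F q\<close> sends a basis vector \<open>b\<close>
  to \<open>X (h b) q\<close>. As many vectors as the dimension of the fibre span it, so
  \<open>F q\<close> is injective by the rank argument.\<close>

lemma exists_trivialization:
  assumes p: "p \<in> points Q"
  obtains W and F :: "'a \<Rightarrow> 'f \<Rightarrow> 'e" where "p \<in> W" "local_trivialization Q D W F"
proof -
  obtain W X where W: "openin (atlas_topology Q) W" "p \<in> W"
    and X: "\<And>i. i < DIM('f) \<Longrightarrow> smooth_vector_field Q W (X i)"
    and span: "\<And>q. q \<in> W \<Longrightarrow> span ((\<lambda>i. X i q) ` {..<DIM('f)}) = fibre D q"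
    using D p unfolding regular_distribution_def by metis
  obtain h where h: "bij_betw h (Basis :: 'f set) {..<DIM('f)}"
    using finite_same_card_bij[of "Basis :: 'f set" "{..<DIM('f)}"] by auto
  have hb: "h b < DIM('f)" if "b \<in> Basis" for b using h that by (auto simp: bij_betw_def)
  define F where "F q e = (\<Sum>b\<in>Basis. (e \<bullet> b) *\<^sub>R X (h b) q)" for q and e :: 'f
  have lin: "linear (F q)" for q
    unfolding F_def by (rule linearI) (simp_all add: inner_add_left scaleR_add_left sum.distrib scaleR_sum_right)
  have Fb: "F q b = X (h b) q" if "b \<in> Basis" for q b
  proof -
    have "F q b = (\<Sum>b'\<in>Basis. if b' = b then X (h b') q else 0)"
      unfolding F_def by (rule sum.cong) (use that in \<open>auto simp: inner_Basis\<close>)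
    then show ?thesis using that by simp
  qed
  have range: "range (F q) = fibre D q" if q: "q \<in> W" for q
  proof
    show "range (F q) \<subseteq> fibre D q"
    proof clarify
      fix e
      have "F q e \<in> span ((\<lambda>i. X i q) ` {..<DIM('f)})"
        unfolding F_def by (intro span_sum span_scale span_base) (use hb in auto)
      then show "F q e \<in> fibre D q" by (simp add: span[OF q])
    qed
    have "(\<lambda>i. X i q) ` {..<DIM('f)} \<subseteq> range (F q)"
    proof clarify
      fix i assume "i < DIM('f)"
      then have "i \<in> h ` Basis" using h by (simp add: bij_betw_def)
      then obtain b where "b \<in> Basis" "h b = i" by blast
      then show "X i q \<in> range (F q)" using Fb[of b q] by (metis rangeI)
    qed
    then have "span ((\<lambda>i. X i q) ` {..<DIM('f)}) \<subseteq> range (F q)"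
      by (rule span_minimal) (rule linear_subspace_image[OF lin subspace_UNIV])
    then show "fibre D q \<subseteq> range (F q)" by (simp add: span[OF q])
  qed
  have inj: "inj (F q)" if q: "q \<in> W" for q
  proof (rule linear_full_rank_imp_inj[OF lin])
    have "q \<in> points Q" using W q by (auto simp: openin_atlas[OF Q])
    then show "dim (range (F q)) = DIM('f)"
      using D range[OF q] by (simp add: regular_distribution_def)
  qed
  have "smooth_vector_field Q W (\<lambda>q. F q e)" for e
    unfolding smooth_vector_field_iff[OF Q]
  proof (intro conjI ballI W(1))
    fix c assume c: "c \<in> Q"
    have o: "open (snd c ` (W \<inter> fst c))" using W(1) c by (simp add: openin_atlas[OF Q])
    have "smooth_on (snd c ` (W \<inter> fst c)) (\<lambda>x. \<Sum>b\<in>Basis. (e \<bullet> b) *\<^sub>R local_field Q c (X (h b)) x)"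
      by (intro smooth_on_sum[OF o] smooth_on_scaleR[OF o] smooth_on_const)
        (use X[OF hb] c smooth_vector_field_iff[OF Q] in blast)
    then show "smooth_on (snd c ` (W \<inter> fst c)) (local_field Q c (\<lambda>q. F q e))"
    proof (rule smooth_on_cong[OF o, THEN iffD2, rotated])
      fix x assume "x \<in> snd c ` (W \<inter> fst c)"
      then have "chart_inv c x \<in> fst c" using chart_inv_eq[OF Q c] by auto
      then show "local_field Q c (\<lambda>q. F q e) x = (\<Sum>b\<in>Basis. (e \<bullet> b) *\<^sub>R local_field Q c (X (h b)) x)"
        unfolding local_field_def F_def
        by (simp add: linear_sum[OF linear_to_coords(1)[OF Q c]] linear_scale[OF linear_to_coords(1)[OF Q c]])
    qed
  qed
  then have "local_trivialization Q D W F"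
    unfolding local_trivialization_def using W(1) lin inj range by blast
  then show ?thesis using that W(2) by blast
qed

text \<open>The Gram matrix of a frame as an endomorphism of \<open>'f\<close>, the form in which
  \<open>smooth_on_linear_solution\<close> takes a matrix.\<close>

definition gram :: "('a \<Rightarrow> 'f \<Rightarrow> 'e) \<Rightarrow> 'a \<Rightarrow> 'f \<Rightarrow> 'f" where
  "gram F q e = (\<Sum>b\<in>Basis. G q (F q e) (F q b) *\<^sub>R b)"

lemma linear_gram:
  assumes F: "local_trivialization Q D W F" and q: "q \<in> W" shows "linear (gram F q)"
proof -
  have p: "q \<in> points Q" using trivialization_subset[OF F] q by blast
  note l = trivialization(1)[OF F q] linear_metric(2)[OF p]
  show ?thesis
    unfolding gram_def by (rule linearI)
      (simp_all add: linear_add[OF l(1)] linear_scale[OF l(1)] linear_add[OF l(2)] linear_scale[OF l(2)]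
        scaleR_add_left sum.distrib scaleR_sum_right)
qed

text \<open>A vector \<open>F q e\<close> with \<open>e\<close> in the kernel is orthogonal to every
  frame vector, hence to itself, and the metric is positive definite.\<close>

lemma inj_gram:
  assumes F: "local_trivialization Q D W F" and q: "q \<in> W" shows "inj (gram F q)"
  unfolding linear_injective_0[OF linear_gram[OF assms]]
proof (intro allI impI)
  have p: "q \<in> points Q" using trivialization_subset[OF F] q by blast
  fix e assume e: "gram F q e = 0"
  have "G q (F q e) (F q b) = 0" if "b \<in> Basis" for b
  proof -
    have "gram F q e \<bullet> b = (\<Sum>b'\<in>Basis. if b' = b then G q (F q e) (F q b') else 0)"
      unfolding gram_def inner_sum_left by (rule sum.cong) (use that in \<open>auto simp: inner_Basis\<close>)
    then show ?thesis using that e by simp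
  qed
  then have "G q (F q e) (F q e) = 0"
    using linear_euclidean_expansion[OF linear_compose[OF trivialization(1)[OF F q] linear_metric(1)[OF p]], of "F q e" e]
    by (simp add: o_def)
  then have "F q e = 0" using metric_pos[OF p] by fastforce
  then show "e = 0" using linear_injective_0[OF trivialization(1)[OF F q]] trivialization(2)[OF F q] by blast
qed

lemma projection_exists:
  assumes q: "q \<in> points Q"
  shows "\<exists>w\<in>fibre D q. \<forall>u\<in>fibre D q. G q (v - w) u = 0"
proof -
  obtain W and F :: "'a \<Rightarrow> 'f \<Rightarrow> 'e" where W: "q \<in> W" and F: "local_trivialization Q D W F"
    using exists_trivialization[OF q] .
  note l = linear_metric(2)[OF q]
  have "surj (gram F q)"
    by (rule linear_injective_imp_surjective[OF linear_gram[OF F W] inj_gram[OF F W]]) simp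
  \<comment> \<open>The normal equations: \<open>e\<close> gives \<open>F q e\<close> the same inner
    products with the frame vectors as \<open>v\<close>.\<close>
  then obtain e where e: "gram F q e = (\<Sum>b\<in>Basis. G q v (F q b) *\<^sub>R b)" by (metis surjE)
  have b: "G q (v - F q e) (F q b) = 0" if "b \<in> Basis" for b
  proof -
    have "(\<Sum>b'\<in>Basis. G q (v - F q e) (F q b') *\<^sub>R b') = 0"
      using e by (simp add: gram_def linear_diff[OF l] scaleR_diff_left sum_subtractf)
    then have "(\<Sum>b'\<in>Basis. G q (v - F q e) (F q b') *\<^sub>R b') \<bullet> b = 0" by simp
    moreover have "(\<Sum>b'\<in>Basis. G q (v - F q e) (F q b') *\<^sub>R b') \<bullet> b =
       (\<Sum>b'\<in>Basis. if b' = b then G q (v - F q e) (F q b') else 0)"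
      unfolding inner_sum_left by (rule sum.cong) (use that in \<open>auto simp: inner_Basis\<close>)
    ultimately show ?thesis using that by simp
  qed
  have "G q (v - F q e) (F q u) = 0" for u
    using linear_euclidean_expansion[OF linear_compose[OF trivialization(1)[OF F W] linear_metric(1)[OF q]], of "v - F q e" u] b
    by (simp add: o_def)
  then show ?thesis unfolding trivialization(3)[OF F W, symmetric] by blast
qed

lemma projection_unique:
  assumes q: "q \<in> points Q" and w: "w \<in> fibre D q" "w' \<in> fibre D q"
    and o: "\<And>u. u \<in> fibre D q \<Longrightarrow> G q (v - w) u = 0" "\<And>u. u \<in> fibre D q \<Longrightarrow> G q (v - w') u = 0"
  shows "w = w'"
proof (rule ccontr)
  assume "w \<noteq> w'"
  have "subspace (fibre D q)" using D q by (simp add: regular_distribution_def)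
  then have "w - w' \<in> fibre D q" using w by (simp add: subspace_diff)
  \<comment> \<open>The first argument equals \<open>w - w'\<close>, so this difference is
    orthogonal to itself.\<close>
  then have "G q ((v - w') - (v - w)) (w - w') = 0"
    using o by (simp only: linear_diff[OF linear_metric(2)[OF q]])
  then show False using metric_pos[OF q, of "w - w'"] \<open>w \<noteq> w'\<close> by simp
qed

lemma fibre_orthogonal_complement:
  "v \<in> fibre (orthogonal_complement G D) q \<longleftrightarrow> (\<forall>u\<in>fibre D q. G q v u = 0)"
  by (simp add: fibre_def orthogonal_complement_def)

text \<open>Uniqueness removes the definite description from
  \<open>orthogonal_projection\<close>.\<close>

lemma projection_eq:
  assumes q: "q \<in> points Q" and w: "w \<in> fibre D q" "\<And>u. u \<in> fibre D q \<Longrightarrow> G q (v - w) u = 0"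
  shows "P (q, v) = (q, w)"
proof -
  have "(THE w. w \<in> fibre D q \<and> v - w \<in> fibre (orthogonal_complement G D) q) = w"
  proof (rule the_equality)
    show "w \<in> fibre D q \<and> v - w \<in> fibre (orthogonal_complement G D) q"
      using w by (simp add: fibre_orthogonal_complement)
    show "w' = w" if "w' \<in> fibre D q \<and> v - w' \<in> fibre (orthogonal_complement G D) q" for w'
    proof (rule projection_unique[OF q _ w(1) _ w(2)])
      show "w' \<in> fibre D q" using that by blast
      show "G q (v - w') u = 0" if "u \<in> fibre D q" for u
        using that \<open>w' \<in> fibre D q \<and> v - w' \<in> fibre (orthogonal_complement G D) q\<close>
        by (simp add: fibre_orthogonal_complement)
    qed
  qed
  then show ?thesis by (simp add: orthogonal_projection_def)
qed

lemma projection: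
  assumes q: "q \<in> points Q"
  shows "snd (P (q, v)) \<in> fibre D q" "u \<in> fibre D q \<Longrightarrow> G q (v - snd (P (q, v))) u = 0"
proof -
  obtain w where "w \<in> fibre D q" "\<forall>u\<in>fibre D q. G q (v - w) u = 0"
    using projection_exists[OF q, of v] by blast
  then show "snd (P (q, v)) \<in> fibre D q" "u \<in> fibre D q \<Longrightarrow> G q (v - snd (P (q, v))) u = 0"
    using projection_eq[OF q, of w v] by simp_all
qed

lemma fst_projection: "fst (P w) = fst w"
  by (cases w) (simp add: orthogonal_projection_def)

lemma projection_in_D:
  assumes "w \<in> points TQ" shows "P w \<in> D"
proof -
  have "snd (P w) \<in> fibre D (fst (P w))"
    unfolding fst_projection using projection(1)[of "fst w" "snd w"] assms by (auto simp: points_tangent)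
  then show ?thesis by (simp add: fibre_def)
qed

lemma projection_ident:
  assumes "w \<in> D" shows "P w = w"
proof -
  note p = D_subset[OF assms]
  have "P (fst w, snd w) = (fst w, snd w)"
    by (rule projection_eq[OF p]) (use assms linear_0[OF linear_metric(2)[OF p]] in \<open>simp_all add: fibre_def\<close>)
  then show ?thesis by simp
qed

text \<open>\<open>riemannian_metric\<close> gives smoothness for fixed coordinate vectors;
  expanding one argument after the other lets both move. The base point is a function
  \<open>x\<close> on a separate parameter set \<open>T\<close>, so that \<open>T\<close> can be a
  chart image in \<open>TQ\<close> or in the distribution, with \<open>x = fst\<close>.\<close>

lemma smooth_on_metric:
  assumes T: "open T" and c: "c \<in> Q"
    and x: "smooth_on T x" "x ` T \<subseteq> snd c ` fst c"
    and a: "smooth_on T a" and b: "smooth_on T b"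
  shows "smooth_on T (\<lambda>z. G (chart_inv c (x z)) (from_coords Q c (chart_inv c (x z)) (a z))
    (from_coords Q c (chart_inv c (x z)) (b z)))"
proof -
  have q: "chart_inv c (x z) \<in> fst c" "chart_inv c (x z) \<in> points Q" if "z \<in> T" for z
  proof -
    show "chart_inv c (x z) \<in> fst c" using x(2) that chart_inv_eq[OF Q c] by force
    then show "chart_inv c (x z) \<in> points Q" using c pointsI by metis
  qed
  have l: "linear (\<lambda>j. G (chart_inv c (x z)) (from_coords Q c (chart_inv c (x z)) i)
      (from_coords Q c (chart_inv c (x z)) j))"
    "linear (\<lambda>i. G (chart_inv c (x z)) (from_coords Q c (chart_inv c (x z)) i)
      (from_coords Q c (chart_inv c (x z)) j))" if "z \<in> T" for z i j
    using linear_compose[OF linear_to_coords(2)[OF Q c q(1)[OF that]] linear_metric(1)[OF q(2)[OF that]]]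
      linear_compose[OF linear_to_coords(2)[OF Q c q(1)[OF that]] linear_metric(2)[OF q(2)[OF that]]]
    by (simp_all add: o_def)
  have g: "smooth_on (snd c ` fst c) (\<lambda>y. G (chart_inv c y) (from_coords Q c (chart_inv c y) i)
      (from_coords Q c (chart_inv c y) j))" for i j
    using G c unfolding riemannian_metric_def case_prod_beta prod.collapse Let_def by blast
  show ?thesis
    by (rule smooth_on_linear_family[OF T l(2) _ a], assumption, rule smooth_on_linear_family[OF T l(1) _ b],
        assumption, rule smooth_on_compose[OF T x(1) g x(2)])
qed

lemma linear_frame:
  assumes c: "c \<in> Q" and F: "local_trivialization Q D W (F :: 'a \<Rightarrow> 'f \<Rightarrow> 'e)" and q: "q \<in> W" "q \<in> fst c"
  shows "linear (\<lambda>e. to_coords Q c q (F q e))"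
  using linear_compose[OF trivialization(1)[OF F q(1)] linear_to_coords(1)[OF Q c q(2)]] by (simp add: o_def)

text \<open>A trivialization is given as smooth for each fixed vector; linearity in the fibre lets
  the vector move with \<open>z\<close>.\<close>

lemma smooth_on_frame:
  assumes c: "c \<in> Q" and F: "local_trivialization Q D W (F :: 'a \<Rightarrow> 'f \<Rightarrow> 'e)"
    and T: "open T" and x: "smooth_on T x" "x ` T \<subseteq> snd c ` (W \<inter> fst c)" and e: "smooth_on T e"
  shows "smooth_on T (\<lambda>z. to_coords Q c (chart_inv c (x z)) (F (chart_inv c (x z)) (e z)))"
proof (rule smooth_on_linear_family[OF T _ _ e])
  have q: "chart_inv c (x z) \<in> W \<inter> fst c" if "z \<in> T" for z
    using x(2) that chart_inv_eq[OF Q c] by force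
  show "linear (\<lambda>e. to_coords Q c (chart_inv c (x z)) (F (chart_inv c (x z)) e))" if "z \<in> T" for z
    using q[OF that] linear_frame[OF c F] by blast
  have "smooth_vector_field Q W (\<lambda>q. F q b)" for b
    using F unfolding local_trivialization_def by blast
  then have "smooth_on (snd c ` (W \<inter> fst c)) (local_field Q c (\<lambda>q. F q b))" for b
    using c unfolding smooth_vector_field_iff[OF Q] by blast
  from smooth_on_compose[OF T x(1) this x(2)]
  show "smooth_on T (\<lambda>z. to_coords Q c (chart_inv c (x z)) (F (chart_inv c (x z)) b))" for b
    by (simp add: local_field_def)
qed

text \<open>The coordinates \<open>d\<close> of an orthogonal projection with respect to a frame \<open>F\<close> solve the linear
  system given by the Gram matrix of \<open>F\<close>.\<close>

lemma smooth_on_frame_coords: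
  assumes c: "c \<in> Q" and F: "local_trivialization Q D W (F :: 'a \<Rightarrow> 'f \<Rightarrow> 'e)"
    and T: "open T" and x: "smooth_on T x" "x ` T \<subseteq> snd c ` (W \<inter> fst c)" and a: "smooth_on T a"
    and d: "\<And>z b. z \<in> T \<Longrightarrow> G (chart_inv c (x z)) (F (chart_inv c (x z)) (d z)) (F (chart_inv c (x z)) b) =
      G (chart_inv c (x z)) (from_coords Q c (chart_inv c (x z)) (a z)) (F (chart_inv c (x z)) b)"
  shows "smooth_on T d"
proof -
  have q: "chart_inv c (x z) \<in> W" "chart_inv c (x z) \<in> fst c" if "z \<in> T" for z
    using x(2) that chart_inv_eq[OF Q c] by force+
  have x': "x ` T \<subseteq> snd c ` fst c" using x(2) by blast
  have frame: "smooth_on T (\<lambda>z. to_coords Q c (chart_inv c (x z)) (F (chart_inv c (x z)) b))" for b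
    by (rule smooth_on_frame[OF c F T x smooth_on_const])
  \<comment> \<open>\<open>smooth_on_metric\<close> takes both arguments in coordinates, so the
    frame vector is passed through \<open>to_coords\<close>. A general \<open>a\<close> covers the
    right-hand side of the system and, with the coordinates of a frame vector as \<open>a\<close>,
    the Gram matrix.\<close>
  have GF: "smooth_on T (\<lambda>z. G (chart_inv c (x z)) (from_coords Q c (chart_inv c (x z)) (a z)) (F (chart_inv c (x z)) b))"
    if a: "smooth_on T a" for a b
    using smooth_on_metric[OF T c x(1) x' a frame[of b]]
    by (rule smooth_on_cong[OF T, THEN iffD2, rotated]) (simp add: to_from_coords(2)[OF Q c q(2)])
  show ?thesis
  proof (rule smooth_on_linear_solution[OF T,
        where A = "\<lambda>z. gram F (chart_inv c (x z))" and
          b = "\<lambda>z. \<Sum>b\<in>Basis. G (chart_inv c (x z)) (from_coords Q c (chart_inv c (x z)) (a z))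
            (F (chart_inv c (x z)) b) *\<^sub>R b"])
    show "smooth_on T (\<lambda>z. gram F (chart_inv c (x z)) e)" for e
    proof -
      have "smooth_on T (\<lambda>z. G (chart_inv c (x z)) (F (chart_inv c (x z)) e) (F (chart_inv c (x z)) b))" for b
        using GF[OF frame[of e], of b]
        by (rule smooth_on_cong[OF T, THEN iffD2, rotated]) (simp add: to_from_coords(2)[OF Q c q(2)])
      then show ?thesis
        unfolding gram_def by (intro smooth_on_sum[OF T] smooth_on_scaleR[OF T] smooth_on_const)
    qed
    show "smooth_on T (\<lambda>z. \<Sum>b\<in>Basis. G (chart_inv c (x z)) (from_coords Q c (chart_inv c (x z)) (a z))
            (F (chart_inv c (x z)) b) *\<^sub>R b)"
      by (intro smooth_on_sum[OF T] smooth_on_scaleR[OF T] smooth_on_const GF a)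
  qed (use linear_gram[OF F q(1)] inj_gram[OF F q(1)] d in \<open>simp_all add: gram_def\<close>)
qed

section \<open>The total space of the distribution as a manifold\<close>

lemma distribution_chart_image:
  assumes F: "local_trivialization Q D W (F :: 'a \<Rightarrow> 'f \<Rightarrow> 'e)" and N: "N \<subseteq> W"
  shows "snd (distribution_chart D c W F) ` {w \<in> D. fst w \<in> N} = snd c ` N \<times> UNIV"
proof
  show "snd (distribution_chart D c W F) ` {w \<in> D. fst w \<in> N} \<subseteq> snd c ` N \<times> UNIV"
    by (auto simp: snd_distribution_chart)
  show "snd c ` N \<times> UNIV \<subseteq> snd (distribution_chart D c W F) ` {w \<in> D. fst w \<in> N}"
  proof clarify
    fix q e assume q: "q \<in> N"
    then have qW: "q \<in> W" using N by blast
    have "(q, F q e) \<in> {w \<in> D. fst w \<in> N}"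
      using trivialization(3)[OF F qW] q by (auto simp: fibre_def)
    moreover have "(snd c q, e) = snd (distribution_chart D c W F) (q, F q e)"
      by (simp add: snd_distribution_chart trivialization_inv(2)[OF F qW])
    ultimately show "(snd c q, e) \<in> snd (distribution_chart D c W F) ` {w \<in> D. fst w \<in> N}" by blast
  qed
qed

text \<open>Makes local representations computable: inverting the chart replaces the inverse of
  \<open>F\<close> by \<open>F\<close> itself.\<close>

lemma distribution_chart_inv:
  assumes c: "c \<in> Q" and F: "local_trivialization Q D W (F :: 'a \<Rightarrow> 'f \<Rightarrow> 'e)"
    and z: "z \<in> snd c ` (fst c \<inter> W) \<times> UNIV"
  shows "chart_inv (distribution_chart D c W F) z = (chart_inv c (fst z), F (chart_inv c (fst z)) (snd z))"
    and "inj_on (snd (distribution_chart D c W F)) (fst (distribution_chart D c W F))"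
proof -
  show inj: "inj_on (snd (distribution_chart D c W F)) (fst (distribution_chart D c W F))"
  proof (rule inj_onI)
    fix w w' assume w: "w \<in> fst (distribution_chart D c W F)" "w' \<in> fst (distribution_chart D c W F)"
      and eq: "snd (distribution_chart D c W F) w = snd (distribution_chart D c W F) w'"
    have 1: "fst w = fst w'"
      using inj_onD[OF smooth_atlas_inj[OF Q c]] w eq
      by (auto simp: fst_distribution_chart snd_distribution_chart)
    have W': "fst w \<in> W" "snd w \<in> fibre D (fst w)" "snd w' \<in> fibre D (fst w')"
      using w by (auto simp: fst_distribution_chart fibre_def)
    note W = W'[folded 1]
    have "inv (F (fst w)) (snd w) = inv (F (fst w)) (snd w')"
      using eq 1 by (simp add: snd_distribution_chart)
    then have "snd w = snd w'"
      using trivialization_inv(1)[OF F W(1) W(2)] trivialization_inv(1)[OF F W(1) W(3)] by metis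
    then show "w = w'" using 1 by (simp add: prod_eqI)
  qed
  obtain q where q: "q \<in> fst c" "q \<in> W" "fst z = snd c q" using z by auto
  have "(q, F q (snd z)) \<in> fst (distribution_chart D c W F)"
    using trivialization(3)[OF F q(2)] q by (auto simp: fst_distribution_chart fibre_def)
  moreover have "z = snd (distribution_chart D c W F) (q, F q (snd z))"
    using q by (simp add: prod_eq_iff snd_distribution_chart trivialization_inv(2)[OF F q(2)])
  ultimately have "chart_inv (distribution_chart D c W F) z = (q, F q (snd z))"
    unfolding chart_inv_def using inv_into_f_f[OF inj] by metis
  then show "chart_inv (distribution_chart D c W F) z = (chart_inv c (fst z), F (chart_inv c (fst z)) (snd z))"
    by (simp add: q(3) chart_inv_eq[OF Q c q(1)])
qed


lemma distribution_chart_in: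
  "c \<in> Q \<Longrightarrow> local_trivialization Q D W F \<Longrightarrow> distribution_chart D c W F \<in> DD"
  unfolding DD distribution_atlas_eq by blast

lemma distribution_chartE:
  assumes "x \<in> DD"
  obtains c W F where "x = distribution_chart D c W F" "c \<in> Q" "local_trivialization Q D W F"
  using assms unfolding DD distribution_atlas_eq by blast

lemma exists_distribution_chart:
  assumes "p \<in> points Q"
  obtains c W F where "c \<in> Q" "local_trivialization Q D W (F :: 'a \<Rightarrow> 'f \<Rightarrow> 'e)" "p \<in> fst c" "p \<in> W"
proof -
  obtain c where "c \<in> Q" "p \<in> fst c" using assms by (auto simp: points_def)
  moreover obtain W and F :: "'a \<Rightarrow> 'f \<Rightarrow> 'e" where "p \<in> W" "local_trivialization Q D W F"
    using exists_trivialization[OF assms] .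
  ultimately show ?thesis using that by blast
qed

lemma points_DD: "points DD = D"
proof
  show "points DD \<subseteq> D"
    unfolding points_def DD distribution_atlas_eq by (auto simp: fst_distribution_chart)
  show "D \<subseteq> points DD"
  proof
    fix w assume w: "w \<in> D"
    obtain c W F where cF: "c \<in> Q" "local_trivialization Q D W (F :: 'a \<Rightarrow> 'f \<Rightarrow> 'e)" "fst w \<in> fst c" "fst w \<in> W"
      using exists_distribution_chart[OF D_subset[OF w]] .
    then have "w \<in> fst (distribution_chart D c W F)" using w by (simp add: fst_distribution_chart)
    then show "w \<in> points DD" by (rule pointsI[OF distribution_chart_in[OF cF(1,2)]])
  qed
qed

lemma open_trivialization_image:
  assumes c: "c \<in> Q" and F: "local_trivialization Q D W (F :: 'a \<Rightarrow> 'f \<Rightarrow> 'e)"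
    and N: "openin (atlas_topology Q) N"
  shows "open (snd c ` (fst c \<inter> W \<inter> N))"
  by (rule open_chart_image[OF Q c])
    (use openin_fst_chart[OF Q c] openin_trivialization[OF F] N in \<open>auto intro: openin_Int\<close>)

text \<open>The fibre part of a change of charts is \<open>inv (F' p) \<circ> F p\<close>. The
  vector \<open>F p e\<close> is its own orthogonal projection, so its coordinates in the frame
  \<open>F'\<close> solve the Gram system of \<open>F'\<close> and depend smoothly on
  \<open>p\<close> and \<open>e\<close>.\<close>

lemma smooth_atlas_DD: "smooth_atlas DD"
  unfolding smooth_atlas_def
proof (intro conjI ballI)
  fix x assume "x \<in> DD"
  then obtain c W F where x: "x = distribution_chart D c W F" and c: "c \<in> Q"
    and F: "local_trivialization Q D W F" by (rule distribution_chartE)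
  show inj: "inj_on (snd x) (fst x)"
  \<comment> \<open>\<open>distribution_chart_inv\<close> asks for a point of the chart image; an
    empty image means an empty chart domain.\<close>
  proof (cases "snd c ` (fst c \<inter> W) \<times> (UNIV :: 'f set) = {}")
    case True
    then show ?thesis by (auto simp: x fst_distribution_chart)
  next
    case False
    then show ?thesis unfolding x using distribution_chart_inv(2)[OF c F] by blast
  qed
  have "snd x ` fst x = snd c ` (fst c \<inter> W) \<times> UNIV"
    unfolding x fst_distribution_chart by (rule distribution_chart_image[OF F]) simp
  then show "open (snd x ` fst x)"
    using open_trivialization_image[OF c F openin_trivialization[OF F]] by (simp add: open_Times)
  fix y assume "y \<in> DD"
  then obtain c' W' F' where y: "y = distribution_chart D c' W' F'" and c': "c' \<in> Q"
    and F': "local_trivialization Q D W' F'" by (rule distribution_chartE)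
  let ?N = "fst c \<inter> W \<inter> (fst c' \<inter> W')"
  let ?S = "snd c ` ?N \<times> (UNIV :: 'f set)"
  have I: "fst x \<inter> fst y = {w \<in> D. fst w \<in> ?N}" by (auto simp: x y fst_distribution_chart)
  have S: "snd x ` (fst x \<inter> fst y) = ?S"
    unfolding I unfolding x by (rule distribution_chart_image[OF F]) blast
  have oN: "open (snd c ` ?N)"
    by (rule open_trivialization_image[OF c F openin_Int[OF openin_fst_chart[OF Q c'] openin_trivialization[OF F']]])
  have o: "open ?S" using oN by (simp add: open_Times)
  then show "open (snd x ` (fst x \<inter> fst y))" unfolding S .
  have fst: "smooth_on ?S fst" and snd: "smooth_on ?S snd"
    using smooth_on_fst[OF o smooth_on_id] smooth_on_snd[OF o smooth_on_id] by simp_all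
  let ?d = "\<lambda>z. inv (F' (chart_inv c (fst z))) (F (chart_inv c (fst z)) (snd z))"
  have q: "chart_inv c (fst z) \<in> ?N" if "z \<in> ?S" for z
    using that chart_inv_eq[OF Q c] by auto
  have "smooth_on ?S ?d"
  proof (rule smooth_on_frame_coords[OF c F' o fst])
    show "fst ` ?S \<subseteq> snd c ` (W' \<inter> fst c)" by auto
    show "smooth_on ?S (\<lambda>z. to_coords Q c (chart_inv c (fst z)) (F (chart_inv c (fst z)) (snd z)))"
      by (rule smooth_on_frame[OF c F o fst _ snd]) auto
    fix z b assume "z \<in> ?S"
    note q = q[OF this]
    let ?q = "chart_inv c (fst z)"
    have "F ?q (snd z) \<in> fibre D ?q" using trivialization(3)[OF F, of ?q] q by blast
    then have "F' ?q (?d z) = F ?q (snd z)" using trivialization_inv(1)[OF F'] q by blast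
    then show "G ?q (F' ?q (?d z)) (F' ?q b) =
        G ?q (from_coords Q c ?q (to_coords Q c ?q (F ?q (snd z)))) (F' ?q b)"
      using to_from_coords(2)[OF Q c, of ?q] q by simp
  qed
  moreover have "smooth_on ?S (\<lambda>z. local_rep c c' id (fst z))"
    by (rule smooth_on_compose[OF o fst smooth_atlas_transition(2)[OF Q c c']]) auto
  ultimately have "smooth_on ?S (\<lambda>z. (local_rep c c' id (fst z), ?d z))"
    by (intro smooth_on_Pair[OF o])
  then show "smooth_on (snd x ` (fst x \<inter> fst y)) (local_rep x y id)"
    unfolding S
  proof (rule smooth_on_cong[OF o, THEN iffD2, rotated])
    fix z assume "z \<in> ?S"
    then have "z \<in> snd c ` (fst c \<inter> W) \<times> UNIV" by auto
    from distribution_chart_inv(1)[OF c F this]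
    show "local_rep x y id z = (local_rep c c' id (fst z), ?d z)"
      by (simp add: local_rep_def x y snd_distribution_chart)
  qed
qed

text \<open>In a frame chart and the tangent chart over the same \<open>c\<close>, the inclusion
  keeps the base coordinates and sends \<open>e\<close> to the coordinates of
  \<open>F p e\<close>.\<close>

lemma smooth_near_inclusion:
  assumes w: "w \<in> D"
  shows "smooth_near DD TQ (\<lambda>w. w) w"
proof -
  obtain c W F where c: "c \<in> Q" and F: "local_trivialization Q D W (F :: 'a \<Rightarrow> 'f \<Rightarrow> 'e)"
    and p: "fst w \<in> fst c" "fst w \<in> W"
    using exists_distribution_chart[OF D_subset[OF w]] .
  let ?x = "distribution_chart D c W F" and ?y = "tangent_chart Q c"
  let ?S = "snd c ` (fst c \<inter> W) \<times> (UNIV :: 'f set)"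
  have x: "?x \<in> DD" by (rule distribution_chart_in[OF c F])
  have S: "snd ?x ` fst ?x = ?S"
    unfolding fst_distribution_chart by (rule distribution_chart_image[OF F]) simp
  have o: "open ?S"
    using open_trivialization_image[OF c F openin_trivialization[OF F]] by (simp add: open_Times)
  have fst: "smooth_on ?S fst" and snd: "smooth_on ?S snd"
    using smooth_on_fst[OF o smooth_on_id] smooth_on_snd[OF o smooth_on_id] by simp_all
  have "smooth_on ?S (\<lambda>z. (fst z, to_coords Q c (chart_inv c (fst z)) (F (chart_inv c (fst z)) (snd z))))"
    by (rule smooth_on_Pair[OF o fst smooth_on_frame[OF c F o fst _ snd]]) auto
  then have "smooth_on (snd ?x ` fst ?x) (local_rep ?x ?y (\<lambda>w. w))"
    unfolding S
  proof (rule smooth_on_cong[OF o, THEN iffD2, rotated])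
    fix z assume z: "z \<in> ?S"
    then have "snd c (chart_inv c (fst z)) = fst z" using chart_inv_eq[OF Q c] by auto
    then show "local_rep ?x ?y (\<lambda>w. w) z =
        (fst z, to_coords Q c (chart_inv c (fst z)) (F (chart_inv c (fst z)) (snd z)))"
      using distribution_chart_inv(1)[OF c F z] by (simp add: local_rep_def snd_tangent_chart)
  qed
  then show ?thesis
    by (intro smooth_nearI[OF x _ openin_fst_chart[OF smooth_atlas_DD x]])
      (use c p w in \<open>auto simp: tangent_atlas_eq fst_distribution_chart fst_tangent_chart\<close>)
qed

text \<open>The frame coordinates of a projected vector solve the Gram system, since the projection
  error is orthogonal to each frame vector.\<close>

lemma smooth_near_projection:
  assumes w: "w \<in> points TQ"
  shows "smooth_near TQ DD P w"
proof -
  have "fst w \<in> points Q" using w by (auto simp: points_tangent)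
  then obtain c W F where c: "c \<in> Q" and F: "local_trivialization Q D W (F :: 'a \<Rightarrow> 'f \<Rightarrow> 'e)"
    and p: "fst w \<in> fst c" "fst w \<in> W"
    using exists_distribution_chart by metis
  let ?x = "tangent_chart Q c" and ?y = "distribution_chart D c W F"
  let ?N = "fst c \<inter> W"
  let ?S = "snd c ` ?N \<times> (UNIV :: 'e set)"
  have x: "?x \<in> TQ" using c by (simp add: tangent_atlas_eq)
  have oN: "openin (atlas_topology Q) ?N"
    using openin_fst_chart[OF Q c] openin_trivialization[OF F] by blast
  have sub: "?N \<times> UNIV \<subseteq> fst ?x" by (auto simp: fst_tangent_chart)
  have S: "snd ?x ` (?N \<times> UNIV) = ?S" by (rule snd_tangent_chart_image[OF Q c]) simp
  have o: "open ?S"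
    using open_trivialization_image[OF c F openin_trivialization[OF F]] by (simp add: open_Times)
  have fst: "smooth_on ?S fst" and snd: "smooth_on ?S snd"
    using smooth_on_fst[OF o smooth_on_id] smooth_on_snd[OF o smooth_on_id] by simp_all
  let ?P = "\<lambda>z. snd (P (chart_inv c (fst z), from_coords Q c (chart_inv c (fst z)) (snd z)))"
  let ?d = "\<lambda>z. inv (F (chart_inv c (fst z))) (?P z)"
  have "smooth_on ?S ?d"
  proof (rule smooth_on_frame_coords[OF c F o fst _ snd])
    show "fst ` ?S \<subseteq> snd c ` (W \<inter> fst c)" by auto
    fix z b assume "z \<in> ?S"
    then have q: "chart_inv c (fst z) \<in> W" using chart_inv_eq[OF Q c] by auto
    let ?q = "chart_inv c (fst z)"
    have qQ: "?q \<in> points Q" using trivialization_subset[OF F] q by blast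
    have "F ?q (?d z) = ?P z" by (rule trivialization_inv(1)[OF F q projection(1)[OF qQ]])
    moreover have "G ?q (from_coords Q c ?q (snd z) - ?P z) (F ?q b) = 0"
      by (rule projection(2)[OF qQ]) (use trivialization(3)[OF F q] in blast)
    ultimately show "G ?q (F ?q (?d z)) (F ?q b) = G ?q (from_coords Q c ?q (snd z)) (F ?q b)"
      by (simp add: linear_diff[OF linear_metric(2)[OF qQ]])
  qed
  then have "smooth_on ?S (\<lambda>z. (fst z, ?d z))" by (rule smooth_on_Pair[OF o fst])
  then have "smooth_on (snd ?x ` (?N \<times> UNIV)) (local_rep ?x ?y P)"
    unfolding S
  proof (rule smooth_on_cong[OF o, THEN iffD2, rotated])
    fix z assume z: "z \<in> ?S"
    then have "z \<in> snd ?x ` (?N \<times> UNIV)" by (simp only: S)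
    then obtain q v where qv: "q \<in> fst c" "z = snd ?x (q, v)" by auto
    have "local_rep ?x ?y P z = snd ?y (P (q, v))"
      unfolding qv(2) by (rule local_rep_eq[OF smooth_atlas_tangent[OF Q] x]) (simp add: fst_tangent_chart qv(1))
    moreover have "snd c (chart_inv c (fst z)) = fst z" "chart_inv c (fst z) = q"
      "from_coords Q c q (snd z) = v"
      using chart_inv_eq[OF Q c qv(1)] to_from_coords(2)[OF Q c qv(1)] by (simp_all add: qv(2) snd_tangent_chart)
    ultimately show "local_rep ?x ?y P z = (fst z, ?d z)"
      by (simp add: snd_distribution_chart fst_projection)
  qed
  moreover have "P ` (?N \<times> UNIV) \<subseteq> fst ?y"
  proof (rule image_subsetI)
    fix w assume w: "w \<in> ?N \<times> (UNIV :: 'e set)"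
    then have "w \<in> points TQ" using pointsI[OF c] by (auto simp: points_tangent)
    then show "P w \<in> fst ?y"
      using w projection_in_D by (auto simp: fst_distribution_chart fst_projection)
  qed
  moreover have "w \<in> ?N \<times> UNIV" using p by (cases w) simp
  ultimately show ?thesis
    using smooth_nearI[OF x distribution_chart_in[OF c F] openin_tangent[OF Q oN] _ sub] by blast
qed

lemma openin_DD_Int:
  assumes "openin (atlas_topology TQ) V"
  shows "openin (atlas_topology DD) {w \<in> D. w \<in> V}"
  using openin_smooth_vimage[OF smooth_atlas_DD smooth_atlas_tangent[OF Q]
      openin_topspace[of "atlas_topology DD", unfolded topspace_atlas[OF smooth_atlas_DD] points_DD]
      smooth_near_inclusion assms] by simp

text \<open>Both \<open>P\<close> and the inclusion are continuous and \<open>P\<close> is a left inverse of the inclusion, so the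
  topology of the distribution is the subspace topology.\<close>

lemma smooth_manifold_DD:
  assumes TQ: "smooth_manifold TQ"
  shows "smooth_manifold DD"
  unfolding smooth_manifold_iff
proof (intro conjI smooth_atlas_DD)
  have H: "Hausdorff_space (atlas_topology TQ)" and C: "second_countable (atlas_topology TQ)"
    using TQ by (simp_all add: smooth_manifold_iff)
  note TTQ = smooth_atlas_tangent[OF Q]
  have DT: "D \<subseteq> points TQ" using D_subset by (auto simp: points_tangent)
  show "Hausdorff_space (atlas_topology DD)"
    unfolding Hausdorff_space_def topspace_atlas[OF smooth_atlas_DD] points_DD
  proof (intro allI impI, elim conjE)
    fix x y assume xy: "x \<in> D" "y \<in> D" "x \<noteq> y"
    then obtain U V where "openin (atlas_topology TQ) U" "openin (atlas_topology TQ) V" "x \<in> U" "y \<in> V" "disjnt U V"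
      using H[unfolded Hausdorff_space_def topspace_atlas[OF TTQ], rule_format, of x y] subsetD[OF DT] by metis
    then show "\<exists>U V. openin (atlas_topology DD) U \<and> openin (atlas_topology DD) V \<and> x \<in> U \<and> y \<in> V \<and> disjnt U V"
      using xy by (intro exI[of _ "{w \<in> D. w \<in> U}"] exI[of _ "{w \<in> D. w \<in> V}"] conjI openin_DD_Int)
        (auto simp: disjnt_def)
  qed
  from C[unfolded second_countable_def] obtain \<B> where B: "countable \<B>"
    and open_B: "\<forall>V\<in>\<B>. openin (atlas_topology TQ) V"
    and base: "\<forall>U x. openin (atlas_topology TQ) U \<and> x \<in> U \<longrightarrow> (\<exists>V\<in>\<B>. x \<in> V \<and> V \<subseteq> U)"
    by (elim exE conjE)
  show "second_countable (atlas_topology DD)"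
    unfolding second_countable_def
  proof (intro exI conjI allI impI ballI)
    show "countable ((\<lambda>V. {w \<in> D. w \<in> V}) ` \<B>)" using B by (rule countable_image)
    show "openin (atlas_topology DD) V" if "V \<in> (\<lambda>V. {w \<in> D. w \<in> V}) ` \<B>" for V
      using that open_B by (auto intro: openin_DD_Int)
    fix N x assume N: "openin (atlas_topology DD) N \<and> x \<in> N"
    then have OD: "N \<subseteq> D" using openin_atlas[OF smooth_atlas_DD] points_DD by blast
    \<comment> \<open>An open set of \<open>TQ\<close> whose trace on \<open>D\<close> is
      \<open>N\<close>, because \<open>P\<close> fixes \<open>D\<close>; a base element inside it
      has its trace inside \<open>N\<close>.\<close>
    have "openin (atlas_topology TQ) {w \<in> points TQ. P w \<in> N}"
      using openin_smooth_vimage[OF TTQ smooth_atlas_DD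
          openin_topspace[of "atlas_topology TQ", unfolded topspace_atlas[OF TTQ]] smooth_near_projection, of N] N
      by simp
    moreover have "x \<in> {w \<in> points TQ. P w \<in> N}" using N OD DT projection_ident[of x] by auto
    ultimately obtain V where V: "V \<in> \<B>" "x \<in> V" "V \<subseteq> {w \<in> points TQ. P w \<in> N}"
      using base[rule_format, of "{w \<in> points TQ. P w \<in> N}" x] by blast
    show "\<exists>V\<in>(\<lambda>V. {w \<in> D. w \<in> V}) ` \<B>. x \<in> V \<and> V \<subseteq> N"
    proof (intro bexI conjI)
      show "{w \<in> D. w \<in> V} \<in> (\<lambda>V. {w \<in> D. w \<in> V}) ` \<B>" using V(1) by (rule imageI)
      show "{w \<in> D. w \<in> V} \<subseteq> N" using V(3) projection_ident by force
    qed (use V N OD in auto)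
  qed
qed

section \<open>The projected discretization map\<close>

lemma discretization_map_projected:
  fixes U :: "(('a \<times> 'e) \<times> ('e \<times> 'e)) set" and R
  defines "Ti \<equiv> tangent_map DD TQ (\<lambda>w. w)"
  assumes R: "discretization_map TQ U R"
  shows "discretization_map DD {w \<in> points (tangent_atlas DD). Ti w \<in> U} (map_prod P P \<circ> R \<circ> Ti)"
proof -
  note S = smooth_atlas_DD and T = smooth_atlas_tangent[OF Q]
  note TS = smooth_atlas_tangent[OF S] and TT = smooth_atlas_tangent[OF T]
  note SS = smooth_atlas_prod[OF S S] and TTp = smooth_atlas_prod[OF T T]
  let ?U = "{w \<in> points (tangent_atlas DD). Ti w \<in> U}"
  have U: "openin (atlas_topology (tangent_atlas TQ)) U"
    and zero: "\<And>x. x \<in> points TQ \<Longrightarrow> (x, 0) \<in> U"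
    and Rs: "\<And>w. w \<in> U \<Longrightarrow> smooth_near (tangent_atlas TQ) (prod_atlas TQ TQ) R w"
    and R0: "\<And>x. x \<in> points TQ \<Longrightarrow> R (x, 0) = (x, x)"
    and Rd: "\<And>x v. x \<in> points TQ \<Longrightarrow> tangent_map_at euclidean_atlas TQ (\<lambda>u. snd (R (x, u))) 0 v
             - tangent_map_at euclidean_atlas TQ (\<lambda>u. fst (R (x, u))) 0 v = v"
    using R unfolding discretization_map_def smooth_map_iff[OF TT TTp] by blast+
  have DT: "x \<in> points TQ" if "x \<in> D" for x
    using D_subset[OF that] by (cases x) (simp add: points_tangent)
  have Ti: "smooth_near (tangent_atlas DD) (tangent_atlas TQ) Ti w" if "fst w \<in> D" for w
    unfolding Ti_def by (rule smooth_near_tangent_map[OF S T smooth_near_inclusion[OF that]])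
  have oU: "openin (atlas_topology (tangent_atlas DD)) ?U"
    by (rule openin_smooth_vimage[OF TS TT openin_topspace[of "atlas_topology (tangent_atlas DD)", unfolded topspace_atlas[OF TS]] Ti U])
      (auto simp: points_tangent[of DD] points_DD)
  define L where "L x = tangent_map_at DD TQ (\<lambda>w. w) x" for x
  have TiL: "Ti (x, u) = (x, L x u)" for x u
    by (simp add: Ti_def tangent_map_def L_def)
  have linL: "linear (L x)" if "x \<in> D" for x
    unfolding L_def by (rule linear_tangent_map_at[OF S T smooth_near_inclusion[OF that]])
  have zeroD: "(x, 0) \<in> ?U" if "x \<in> D" for x
    using that zero[OF DT[OF that]] linear_0[OF linL[OF that]] by (simp add: TiL points_tangent[of DD] points_DD)
  have comp: "smooth_near (tangent_atlas TQ) TQ (\<lambda>w. fst (R w)) w"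
    "smooth_near (tangent_atlas TQ) TQ (\<lambda>w. snd (R w)) w" if "w \<in> U" for w
    using smooth_near_compose[OF TT TTp T Rs[OF that] smooth_near_fst_snd(1)[OF T T smooth_near_points(2)[OF Rs[OF that]]]]
      smooth_near_compose[OF TT TTp T Rs[OF that] smooth_near_fst_snd(2)[OF T T smooth_near_points(2)[OF Rs[OF that]]]] .
  have "smooth_near (tangent_atlas DD) (prod_atlas DD DD) (map_prod P P \<circ> R \<circ> Ti) w" if w: "w \<in> ?U" for w
  proof -
    have fw: "fst w \<in> D" and wU: "Ti w \<in> U" using w by (auto simp: points_tangent[of DD] points_DD)
    have PR: "smooth_near (tangent_atlas DD) DD (\<lambda>w. P (h (Ti w))) w"
      if h: "smooth_near (tangent_atlas TQ) TQ h (Ti w)" for h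
      by (rule smooth_near_compose[OF TS T S smooth_near_compose[OF TS TT T Ti[OF fw] h]
            smooth_near_projection[OF smooth_near_points(2)[OF h]]])
    have "smooth_near (tangent_atlas DD) (prod_atlas DD DD) (\<lambda>w. (P (fst (R (Ti w))), P (snd (R (Ti w))))) w"
      by (rule smooth_near_Pair[OF TS S S PR[OF comp(1)[OF wU]] PR[OF comp(2)[OF wU]]])
    then show ?thesis by (simp add: comp_def map_prod_def case_prod_beta)
  qed
  then have smooth: "smooth_map (tangent_atlas DD) (prod_atlas DD DD) ?U (map_prod P P \<circ> R \<circ> Ti)"
    unfolding smooth_map_iff[OF TS SS] using oU by blast
  \<comment> \<open>\<open>h\<close> stands for either component of \<open>R\<close>. The value
    \<open>h (x, 0) = x\<close> places the derivative of \<open>P\<close> at \<open>x\<close> in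
    both cases, and the inner derivative is \<open>L x\<close> itself by linearity.\<close>
  have deriv: "tangent_map_at euclidean_atlas DD (\<lambda>u. P (h (x, L x u))) 0 v =
      tangent_map_at TQ DD P x (tangent_map_at euclidean_atlas TQ (\<lambda>u. h (x, u)) 0 (L x v))"
    if x: "x \<in> D" and h: "smooth_near (tangent_atlas TQ) TQ h (x, 0)" and h0: "h (x, 0) = x" for x h v
  proof -
    have L0: "L x 0 = 0" by (rule linear_0[OF linL[OF x]])
    have f: "smooth_near euclidean_atlas TQ (\<lambda>u. h (x, u)) 0"
      by (rule smooth_near_compose[OF smooth_atlas_euclidean TT T smooth_near_fibre[OF T DT[OF x]] h])
    note sL = smooth_near_linear[OF linL[OF x], of 0]
    have fL: "smooth_near euclidean_atlas TQ (\<lambda>u. h (x, L x u)) 0"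
      by (rule smooth_near_compose[OF smooth_atlas_euclidean smooth_atlas_euclidean T sL, of "\<lambda>u. h (x, u)"])
        (simp add: L0 f)
    have "tangent_map_at euclidean_atlas DD (\<lambda>u. P (h (x, L x u))) 0 v =
        tangent_map_at TQ DD P x (tangent_map_at euclidean_atlas TQ (\<lambda>u. h (x, L x u)) 0 v)"
      using tangent_map_compose[OF smooth_atlas_euclidean T S fL, of P v] smooth_near_projection[OF DT[OF x]]
      by (simp add: L0 h0)
    also have "tangent_map_at euclidean_atlas TQ (\<lambda>u. h (x, L x u)) 0 v =
        tangent_map_at euclidean_atlas TQ (\<lambda>u. h (x, u)) 0 (L x v)"
      using tangent_map_compose[OF smooth_atlas_euclidean smooth_atlas_euclidean T sL, of "\<lambda>u. h (x, u)" v] f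
      by (simp add: L0 tangent_map_at_linear[OF linL[OF x]])
    finally show ?thesis .
  qed
  \<comment> \<open>The chain rule read backwards: \<open>P\<close> composed with the inclusion
    agrees with \<open>id\<close> on all of \<open>D\<close>, which is an open neighbourhood of
    \<open>x\<close> in \<open>DD\<close>.\<close>
  have PL: "tangent_map_at TQ DD P x (L x v) = v" if x: "x \<in> D" for x v
  proof -
    have "tangent_map_at TQ DD P x (L x v) = tangent_map_at DD DD (\<lambda>w. P w) x v"
      unfolding L_def
      by (rule tangent_map_compose[OF S T S smooth_near_inclusion[OF x] smooth_near_projection[OF DT[OF x]], symmetric])
    also have "tangent_map_at DD DD (\<lambda>w. P w) x = tangent_map_at DD DD id x"
      by (rule tangent_map_at_cong[OF S openin_topspace[of "atlas_topology DD", unfolded topspace_atlas[OF S] points_DD] x])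
        (simp add: projection_ident)
    finally show ?thesis using tangent_map_at_id[OF S, of x v] x by (simp add: points_DD)
  qed
  have "tangent_map_at euclidean_atlas DD (\<lambda>u. snd ((map_prod P P \<circ> R \<circ> Ti) (x, u))) 0 v
      - tangent_map_at euclidean_atlas DD (\<lambda>u. fst ((map_prod P P \<circ> R \<circ> Ti) (x, u))) 0 v = v"
    if x: "x \<in> D" for x v
  proof -
    note c = comp[OF zero[OF DT[OF x]]]
    \<comment> \<open>Linearity of the derivative of \<open>P\<close> at \<open>x\<close> moves the
      difference inside, where the condition on \<open>R\<close> is applied to the vector
      \<open>L x v\<close>.\<close>
    have "tangent_map_at euclidean_atlas DD (\<lambda>u. P (snd (R (x, L x u)))) 0 v
      - tangent_map_at euclidean_atlas DD (\<lambda>u. P (fst (R (x, L x u)))) 0 v =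
      tangent_map_at TQ DD P x (tangent_map_at euclidean_atlas TQ (\<lambda>u. snd (R (x, u))) 0 (L x v)
        - tangent_map_at euclidean_atlas TQ (\<lambda>u. fst (R (x, u))) 0 (L x v))"
      using deriv[OF x c(1), of v] deriv[OF x c(2), of v] R0[OF DT[OF x]]
      by (simp add: linear_diff[OF linear_tangent_map_at[OF T S smooth_near_projection[OF DT[OF x]]]])
    also have "\<dots> = v" by (simp only: Rd[OF DT[OF x]] PL[OF x])
    finally show ?thesis by (simp add: TiL)
  qed
  note deriv_eq = this
  have val: "(map_prod P P \<circ> R \<circ> Ti) (x, 0) = (x, x)" if "x \<in> D" for x
    using that by (simp add: TiL linear_0[OF linL] R0[OF DT] projection_ident)
  have "smooth_manifold TQ" using R by (simp add: discretization_map_def)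
  from smooth_manifold_DD[OF this] show ?thesis
    unfolding discretization_map_def points_DD
    by (intro conjI ballI allI oU zeroD smooth deriv_eq val)
qed

end

theorem proposition3:
  fixes Q :: "('a, 'e::euclidean_space) chart set"
    and G :: "'a \<Rightarrow> 'e \<Rightarrow> 'e \<Rightarrow> real"
    and D :: "('a \<times> 'e) set"
    and U :: "(('a \<times> 'e) \<times> ('e \<times> 'e)) set"
    and R\<^sub>d :: "('a \<times> 'e) \<times> ('e \<times> 'e) \<Rightarrow> ('a \<times> 'e) \<times> ('a \<times> 'e)"
    and n k :: nat
  defines "TQ \<equiv> tangent_atlas Q"
    and "\<D> \<equiv> (distribution_atlas Q D :: ('a \<times> 'e, 'e \<times> 'f::euclidean_space) chart set)"
    and "P \<equiv> orthogonal_projection G D"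
  defines "Ti \<equiv> tangent_map \<D> TQ (\<lambda>w. w)"
  assumes "smooth_manifold Q" and "DIM('e) = n"
    and "riemannian_metric Q G"
    and "regular_distribution Q k D" and "DIM('f) = k"
    and "non_integrable Q D"
    and "discretization_map TQ U R\<^sub>d"
  shows "discretization_map \<D> {w \<in> points (tangent_atlas \<D>). Ti w \<in> U}
           (map_prod P P \<circ> R\<^sub>d \<circ> Ti)"
proof -
  \<comment> \<open>The rank \<open>k\<close> enters the locale as \<open>DIM('f)\<close>, and
    \<open>Q\<close> through its chart conditions.\<close>
  interpret riemannian_distribution Q G D \<D>
    using assms(5,7-9) by unfold_locales (simp_all add: \<D>_def smooth_manifold_iff)
  show ?thesis
    using discretization_map_projected assms(11) unfolding Ti_def TQ_def P_def by blast
qed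

end
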